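(* Let $(X,Z)$ be a pair of Banach spaces such that there is a constant $C\ge1$, which only depends on $X$ and $Z$, such that for every closed subset $A\subset X$ and every Lipschitz mapping $f:A\to Z$ satisfying the mean value condition for a bounded map $D$ with $M=\sup\{\|D(y)\|:y\in A\}<\infty$, there exists a $C^1$ smooth and Lipschitz mapping $G:X\to Z$ with $G|_A=f$ and $\operatorname{Lip}(G)\le C(M+\operatorname{Lip}(f))$. Then the pair $(X,Z)$ satisfies property ( * ). Therefore, for a pair of Banach spaces $(X,Z)$, the existence of a constant $C\ge1$, which only depends on $X$ and $Z$, such that for every closed subset $A\subset X$ and every Lipschitz mapping $f:A\to Z$ satisfying the mean value condition for a bounded map $D$ with $M=\sup\{\|D(y)\|:y\in A\}<\infty$, there exists a $C^1$ smooth and Lipschitz mapping $G:X\to Z$ with $G|_A=f$ and $\operatorname{Lip}(G)\le C(M+\operatorname{Lip}(f))$, is equivalent to property ( * ).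
   Context: Banach spaces are real; $C^1$ smooth means continuously Fréchet differentiable. $\mathcal{L}(X,Z)$ is the space of bounded linear maps $X\to Z$ with the operator norm. For a mapping $f:A\to Z$ with $A\subset X$, $\operatorname{Lip}(f)=\sup\{\|f(x)-f(y)\|/\|x-y\| : x,y\in A,\ x\neq y\}$ (equal to $0$ if $A$ has at most one point). Property ( * ): the pair $(X,Z)$ has property ( * ) if there is a constant $C_0\ge 1$, depending only on $X$ and $Z$, such that for every subset $A\subset X$, every Lipschitz mapping $f:A\to Z$ and every $\varepsilon>0$, there is a $C^1$ smooth and Lipschitz mapping $g:X\to Z$ such that $\|f(x)-g(x)\|<\varepsilon$ for all $x\in A$ and $\operatorname{Lip}(g)\le C_0\operatorname{Lip}(f)$. Mean value condition for a bounded map: a mapping $f:A\to Z$, with $A\subset X$ closed, satisfies the mean value condition for a bounded map $D$ if $D:A\to\mathcal{L}(X,Z)$ is continuous, $\sup\{\|D(y)\|:y\in A\}<\infty$, and for every $y\in A$ and every $\varepsilon>0$ there is an open ball $B(y,r)$ in $X$ such that $\|f(z)-f(w)-D(y)(z-w)\|\le\varepsilon\|z-w\|$ for every $z,w\in A\cap B(y,r)$. *)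

theory Defs
  imports "HOL-Analysis.Analysis"
begin

text \<open>
  A mapping defined on a subset \<open>A\<close> is a total function together with \<open>A\<close>; none of the
  notions below depends on its values off \<open>A\<close>.  The supremum of the empty set is taken to
  be \<open>0\<close>, since \<open>Sup {}\<close> is unspecified for type \<^typ>\<open>real\<close>, and \<open>Sup\<close> is
  meaningful only for sets that are bounded above.  Hence \<open>Lip A f\<close> is used only together
  with \<open>lipschitz_map A f\<close>, and \<open>sup_norm A D\<close> only when the values of \<open>D\<close> on \<open>A\<close>
  are bounded.
\<close>

definition lipschitz_map :: "'a::real_normed_vector set \<Rightarrow> ('a \<Rightarrow> 'b::real_normed_vector) \<Rightarrow> bool"
  where "lipschitz_map A f \<longleftrightarrow> (\<exists>L. L-lipschitz_on A f)"

definition Lip :: "'a::real_normed_vector set \<Rightarrow> ('a \<Rightarrow> 'b::real_normed_vector) \<Rightarrow> real"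
  where "Lip A f =
    (if \<exists>x\<in>A. \<exists>y\<in>A. x \<noteq> y
     then Sup {norm (f x - f y) / norm (x - y) | x y. x \<in> A \<and> y \<in> A \<and> x \<noteq> y}
     else 0)"

definition sup_norm :: "'a set \<Rightarrow> ('a \<Rightarrow> 'b::real_normed_vector) \<Rightarrow> real"
  where "sup_norm A D = (if A = {} then 0 else (SUP y\<in>A. norm (D y)))"

definition C1_smooth :: "('a::real_normed_vector \<Rightarrow> 'b::real_normed_vector) \<Rightarrow> bool"
  where "C1_smooth g \<longleftrightarrow>
    (\<exists>g' :: 'a \<Rightarrow> 'a \<Rightarrow>\<^sub>L 'b.
      (\<forall>x. (g has_derivative blinfun_apply (g' x)) (at x)) \<and> continuous_on UNIV g')"

definition property_star :: "'a::banach itself \<Rightarrow> 'b::banach itself \<Rightarrow> bool"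
  where "property_star (_ :: 'a itself) (_ :: 'b itself) \<longleftrightarrow>
    (\<exists>C\<^sub>0\<ge>1. \<forall>(A :: 'a set) (f :: 'a \<Rightarrow> 'b). \<forall>\<epsilon>>0. lipschitz_map A f \<longrightarrow>
      (\<exists>g :: 'a \<Rightarrow> 'b. C1_smooth g \<and> lipschitz_map UNIV g \<and>
        (\<forall>x\<in>A. norm (f x - g x) < \<epsilon>) \<and> Lip UNIV g \<le> C\<^sub>0 * Lip A f))"

definition mean_value_condition_bounded ::
  "'a::real_normed_vector set \<Rightarrow> ('a \<Rightarrow> 'b::real_normed_vector) \<Rightarrow> ('a \<Rightarrow> 'a \<Rightarrow>\<^sub>L 'b) \<Rightarrow> bool"
  where "mean_value_condition_bounded A f D \<longleftrightarrow>
    continuous_on A D \<and> bdd_above ((\<lambda>y. norm (D y)) ` A) \<and>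
    (\<forall>y\<in>A. \<forall>\<epsilon>>0. \<exists>r>0. \<forall>z\<in>A \<inter> ball y r. \<forall>w\<in>A \<inter> ball y r.
      norm (f z - f w - D y (z - w)) \<le> \<epsilon> * norm (z - w))"

definition C1_Lipschitz_extension_property :: "'a::banach itself \<Rightarrow> 'b::banach itself \<Rightarrow> bool"
  where "C1_Lipschitz_extension_property (_ :: 'a itself) (_ :: 'b itself) \<longleftrightarrow>
    (\<exists>C\<ge>1. \<forall>(A :: 'a set) (f :: 'a \<Rightarrow> 'b) (D :: 'a \<Rightarrow> 'a \<Rightarrow>\<^sub>L 'b).
      closed A \<longrightarrow> lipschitz_map A f \<longrightarrow> mean_value_condition_bounded A f D \<longrightarrow>
      (\<exists>G :: 'a \<Rightarrow> 'b. C1_smooth G \<and> lipschitz_map UNIV G \<and>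
        (\<forall>x\<in>A. G x = f x) \<and> Lip UNIV G \<le> C * (sup_norm A D + Lip A f)))"

end

theory Submission
  imports Defs
begin

text \<open>
  \<^bold>\<open>Extension implies approximation.\<close>  Replace the domain \<open>A\<close> of a Lipschitz mapping \<open>f\<close> by a maximal
  \<open>\<delta>\<close>-separated subset \<open>N\<close>.  All points of \<open>N\<close> are uniformly isolated, so \<open>f\<close> restricted to \<open>N\<close>
  satisfies the mean value condition for \<open>D = 0\<close> and has a smooth extension whose Lipschitz constant is
  controlled by that of \<open>f\<close> alone.  Since every point of \<open>A\<close> is \<open>\<delta>\<close>-close to \<open>N\<close>, this extension is
  uniformly close to \<open>f\<close> on \<open>A\<close> (\<open>extension_imp_property_star\<close>).

  \<^bold>\<open>Approximation implies extension.\<close>  Let \<open>B\<close> bound the Lipschitz constant of \<open>f\<close> and the norm of \<open>D\<close> on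
  \<open>A\<close>.  It suffices to find a smooth \<open>g\<close> with \<open>\<parallel>g'\<parallel>\<close> at most a constant times \<open>B\<close> such that \<open>f - g\<close> and
  \<open>D - g'\<close> satisfy the same hypotheses with \<open>B / 2\<close> (\<open>C1_approximation_halving\<close>): iterating and
  summing the geometrically decreasing corrections gives a smooth mapping that agrees with \<open>f\<close> on \<open>A\<close>.

  To find \<open>g\<close>, observe that near \<open>y \<in> A\<close> the mapping \<open>f - D y\<close> has a small Lipschitz constant on \<open>A\<close> by the
  mean value condition; the approximation property turns it into a smooth \<open>h\<close> with small Lipschitz
  constant, and \<open>D y + h\<close> is a local model of \<open>f\<close> on \<open>A\<close>, in value to any prescribed accuracy and in
  derivative up to a fixed small error.  The local models are glued by a partition of unity \<open>\<psi>\<close> which is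
  indexed by the natural numbers although \<open>A\<close> may be nonseparable: every \<open>\<psi> k\<close> is supported on a uniformly
  separated family of sets on each of which one local model is used, so \<open>k\<close> determines both the slope of
  \<open>\<psi> k\<close> and the accuracy demanded of the models that it multiplies
  (\<open>layered_partition_of_unity\<close>).  The scalar bumps come from applying the approximation property to
  real-valued distance functions times a fixed vector and composing with a norming functional.

  A sum of local models is close to \<open>f\<close> only in a neighbourhood of \<open>A\<close> whose width is not bounded below.
  Therefore the partial sums are completed to mappings \<open>F n\<close> by a global approximation of \<open>f\<close>
  with error at most a multiple of a small number \<open>\<rho> n\<close>; within distance \<open>\<rho> n\<close> of \<open>A\<close> the mapping \<open>F n\<close> has bounded
  derivative and differs from its neighbour in the sequence by at most a multiple of \<open>\<rho> n\<close>.  Switching from \<open>F n\<close> to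
  \<open>F (n + 1)\<close> within distance \<open>\<rho> (n + 1)\<close> of \<open>A\<close> then costs only a bounded amount of slope, and since the
  switching zones do not overlap these costs do not add up (\<open>diagonal_gluing\<close>).
\<close>

section \<open>A norming functional\<close>

definition sublinear :: "('a::real_vector \<Rightarrow> real) \<Rightarrow> bool"
  where "sublinear p \<longleftrightarrow> (\<forall>x y. p (x + y) \<le> p x + p y) \<and> (\<forall>x. \<forall>c>0. p (c *\<^sub>R x) \<le> c * p x)"

lemma sublinear_add: "sublinear p \<Longrightarrow> p (x + y) \<le> p x + p y"
  by (simp add: sublinear_def)

lemma sublinear_scale:
  assumes "sublinear p" "c > 0"
  shows "p (c *\<^sub>R x) = c * p x"
proof -
  have "p (inverse c *\<^sub>R (c *\<^sub>R x)) \<le> inverse c * p (c *\<^sub>R x)"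
    using assms unfolding sublinear_def by (meson positive_imp_inverse_positive)
  hence "c * p x \<le> p (c *\<^sub>R x)" using assms(2) by (simp add: field_simps)
  thus ?thesis using assms unfolding sublinear_def by (meson antisym)
qed

lemma sublinear_zero: "sublinear p \<Longrightarrow> p 0 = 0"
  using sublinear_scale[of p 2 0] by simp

lemma sublinear_scale_nonneg: "sublinear p \<Longrightarrow> c \<ge> 0 \<Longrightarrow> p (c *\<^sub>R x) = c * p x"
  by (cases "c = 0") (simp_all add: sublinear_zero sublinear_scale)

lemma sublinear_neg: "sublinear p \<Longrightarrow> - p (- x) \<le> p x"
  using sublinear_add[of p x "-x"] sublinear_zero[of p] by simp

lemma sublinear_norm: "sublinear (norm :: 'a::real_normed_vector \<Rightarrow> real)"
  by (simp add: sublinear_def norm_triangle_ineq)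

text \<open>
  The witness is the infimum of \<open>p (x + t y) - t p y\<close> over \<open>t \<ge> 0\<close>.  The construction serves twice:
  applied to the norm it prescribes a value of the functional, and applied to a minimal sublinear
  functional it cannot lower anything, which forces additivity.
\<close>
lemma sublinear_lower:
  assumes p: "sublinear p"
  obtains q where "sublinear q" "\<And>x. q x \<le> p x" "\<And>x. q x \<le> p (x + y) - p y"
proof -
  define q where "q = (\<lambda>x. INF t\<in>{0..}. p (x + t *\<^sub>R y) - t * p y)"
  have low: "p (x + t *\<^sub>R y) - t * p y \<ge> - p (- x)" if "t \<ge> 0" for x t
    using sublinear_add[OF p, of "x + t *\<^sub>R y" "- x"] sublinear_scale_nonneg[OF p that, of y] by simp
  have bdd: "bdd_below ((\<lambda>t. p (x + t *\<^sub>R y) - t * p y) ` {0..})" for x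
    using low by (intro bdd_belowI[where m = "- p (- x)"]) auto
  have le: "q x \<le> p (x + t *\<^sub>R y) - t * p y" if "t \<ge> 0" for x t
    unfolding q_def using that by (intro cINF_lower bdd) auto
  have ge: "m \<le> q x" if "\<And>t. t \<ge> 0 \<Longrightarrow> m \<le> p (x + t *\<^sub>R y) - t * p y" for m x
    unfolding q_def using that by (intro cINF_greatest) auto
  have "q (a + b) \<le> q a + q b" for a b
  proof -
    have "q (a + b) - q a \<le> p (b + t *\<^sub>R y) - t * p y" if t: "t \<ge> 0" for t
    proof -
      have "q (a + b) - (p (b + t *\<^sub>R y) - t * p y) \<le> p (a + s *\<^sub>R y) - s * p y" if "s \<ge> 0" for s
        using le[of "s + t" "a + b"] sublinear_add[OF p, of "a + s *\<^sub>R y" "b + t *\<^sub>R y"] t that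
        by (simp add: algebra_simps)
      from ge[OF this] show ?thesis by simp
    qed
    from ge[OF this] show ?thesis by simp
  qed
  moreover have "q (c *\<^sub>R x) \<le> c * q x" if c: "c > 0" for c x
  proof -
    have "q (c *\<^sub>R x) / c \<le> p (x + t *\<^sub>R y) - t * p y" if "t \<ge> 0" for t
      using le[of "c * t" "c *\<^sub>R x"] sublinear_scale[OF p c, of "x + t *\<^sub>R y"] that c
      by (simp add: field_simps)
    from ge[OF this] show ?thesis using c by (simp add: field_simps)
  qed
  ultimately have "sublinear q" by (simp add: sublinear_def)
  with le[of 0] le[of 1] show ?thesis by (intro that[of q]) auto
qed

text \<open>
  The analytic Hahn--Banach theorem in the form needed here.  By Zorn's lemma there is a minimal
  sublinear functional below the norm that is at most \<open>- norm e\<close> at \<open>- e\<close>, and a minimal sublinear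
  functional is linear.
\<close>
lemma norming_functional:
  fixes e :: "'a::real_normed_vector"
  assumes "e \<noteq> 0"
  obtains \<phi> :: "'a \<Rightarrow>\<^sub>L real" where "blinfun_apply \<phi> e = 1"
proof -
  obtain p0 :: "'a \<Rightarrow> real" where p0: "sublinear p0" "\<And>x. p0 x \<le> norm x"
    "\<And>x. p0 x \<le> norm (x + e) - norm e"
    using sublinear_lower[OF sublinear_norm, of e] by metis
  define S where "S = {p. sublinear p \<and> p \<le> p0}"
  define R where "R = (\<lambda>p q :: 'a \<Rightarrow> real. q \<le> p)"
  have lowb: "- norm x \<le> p x" if "p \<in> S" for p x
    using that sublinear_neg[of p x] p0(2)[of "-x"] unfolding S_def le_fun_def
    by (smt (verit) mem_Collect_eq norm_minus_cancel)
  have "\<exists>m\<in>S. \<forall>a\<in>S. R m a \<longrightarrow> a = m"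
  proof (rule predicate_Zorn)
    show "partial_order_on S (relation_of R S)"
      by (rule partial_order_on_relation_ofI) (auto simp: R_def)
    fix C assume C: "C \<in> Chains (relation_of R S)"
    hence CS: "C \<subseteq> S" and tot: "\<And>p q. p \<in> C \<Longrightarrow> q \<in> C \<Longrightarrow> p \<le> q \<or> q \<le> p"
      unfolding Chains_def relation_of_def R_def by blast+
    show "\<exists>u\<in>S. \<forall>a\<in>C. R a u"
    proof (cases "C = {}")
      case True
      thus ?thesis using p0(1) by (auto simp: S_def)
    next
      case ne: False
      define u where "u = (\<lambda>x. INF p\<in>C. p x)"
      have bdd: "bdd_below ((\<lambda>p. p x) ` C)" for x
        using lowb CS by (intro bdd_belowI[where m = "- norm x"]) auto
      have le: "u x \<le> p x" if "p \<in> C" for p x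
        unfolding u_def using that by (intro cINF_lower bdd)
      have ge: "m \<le> u x" if "\<And>p. p \<in> C \<Longrightarrow> m \<le> p x" for m x
        unfolding u_def using that ne by (intro cINF_greatest)
      have sub: "sublinear p" if "p \<in> C" for p using CS that by (auto simp: S_def)
      have "u (a + b) \<le> u a + u b" for a b
      proof -
        have "u (a + b) - u a \<le> q b" if q: "q \<in> C" for q
        proof -
          have "u (a + b) - q b \<le> p a" if p: "p \<in> C" for p
          proof -
            obtain r where "r \<in> C" "r \<le> p" "r \<le> q" using tot[OF p q] p q by blast
            thus ?thesis using le[of r "a + b"] sublinear_add[OF sub, of r a b]
              by (smt (verit) le_fun_def)
          qed
          hence "u (a + b) - q b \<le> u a" by (rule ge)
          thus ?thesis by simp
        qed
        hence "u (a + b) - u a \<le> u b" by (rule ge)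
        thus ?thesis by simp
      qed
      moreover have "u (c *\<^sub>R x) \<le> c * u x" if c: "c > 0" for c x
      proof -
        have "u (c *\<^sub>R x) / c \<le> p x" if "p \<in> C" for p
          using le[OF that, of "c *\<^sub>R x"] sublinear_scale[OF sub[OF that] c, of x] c
          by (simp add: field_simps)
        hence "u (c *\<^sub>R x) / c \<le> u x" by (rule ge)
        thus ?thesis using c by (simp add: field_simps)
      qed
      moreover have "u \<le> p0"
        using ne le CS unfolding S_def le_fun_def by (blast intro: order_trans)
      ultimately have "u \<in> S" by (simp add: S_def sublinear_def)
      thus ?thesis using le by (auto simp: R_def le_fun_def)
    qed
  qed
  then obtain m where m: "m \<in> S" and min: "\<And>a. a \<in> S \<Longrightarrow> a \<le> m \<Longrightarrow> a = m"
    unfolding R_def by blast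
  have sm: "sublinear m" and mp0: "m x \<le> p0 x" for x
    using m by (auto simp: S_def le_fun_def)
  have add: "m (x + y) = m x + m y" for x y
  proof -
    obtain q where q: "sublinear q" "\<And>x. q x \<le> m x" "\<And>x. q x \<le> m (x + y) - m y"
      using sublinear_lower[OF sm, of y] by metis
    have "q \<in> S" using q mp0 unfolding S_def le_fun_def by (blast intro: order_trans)
    hence "q = m" using q(2) by (intro min) (auto simp: le_fun_def)
    thus ?thesis using q(3)[of x] sublinear_add[OF sm, of x y] by simp
  qed
  have neg: "m (- x) = - m x" for x
    using add[of x "- x"] sublinear_zero[OF sm] by simp
  have scale: "m (c *\<^sub>R x) = c *\<^sub>R m x" for c x
    using sublinear_scale_nonneg[OF sm, of c x] sublinear_scale_nonneg[OF sm, of "- c" x] neg[of "c *\<^sub>R x"]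
    by (cases "c \<ge> 0") auto
  have "bounded_linear m"
  proof (rule bounded_linear_intro[where K = 1])
    show "norm (m x) \<le> norm x * 1" for x
      using lowb[OF m, of x] mp0[of x] p0(2)[of x] by simp
  qed (use add scale in auto)
  hence bl: "bounded_linear (\<lambda>x. m x / m e)" by (rule bounded_linear_divide[THEN bounded_linear_compose])
  have "m (- e) \<le> - norm e" using mp0[of "- e"] p0(3)[of "- e"] by simp
  hence "m e \<noteq> 0" using neg[of e] assms by auto
  with bl show ?thesis
    by (intro that[of "Blinfun (\<lambda>x. m x / m e)"]) (simp add: bounded_linear_Blinfun_apply)
qed

section \<open>Continuously differentiable mappings\<close>

text \<open>
  The Frechet derivative as a bounded operator, so that its norm and its continuity are available
  without carrying a derivative along with every mapping.  Its value is arbitrary where the mapping is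
  not differentiable.
\<close>
definition bderiv :: "('a::real_normed_vector \<Rightarrow> 'b::real_normed_vector) \<Rightarrow> 'a \<Rightarrow> 'a \<Rightarrow>\<^sub>L 'b"
  where "bderiv g x = (SOME T. (g has_derivative blinfun_apply T) (at x))"

lemma bderiv_eqI:
  assumes "(g has_derivative blinfun_apply T) (at x)"
  shows "bderiv g x = T"
proof -
  have "(g has_derivative blinfun_apply (bderiv g x)) (at x)"
    unfolding bderiv_def using assms by (rule someI)
  from has_derivative_unique[OF this assms] show ?thesis
    by (simp add: blinfun_apply_inject)
qed

lemma C1_smoothI:
  assumes "\<And>x. (g has_derivative blinfun_apply (g' x)) (at x)" "continuous_on UNIV g'"
  shows "C1_smooth g"
  using assms unfolding C1_smooth_def by blast

lemma C1_smooth_has_derivative: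
  assumes "C1_smooth g"
  shows "(g has_derivative blinfun_apply (bderiv g x)) (at x)"
  using assms bderiv_eqI unfolding C1_smooth_def by metis

lemma C1_smooth_continuous_bderiv:
  assumes "C1_smooth g"
  shows "continuous_on UNIV (bderiv g)"
proof -
  obtain g' where g': "\<And>x. (g has_derivative blinfun_apply (g' x)) (at x)" "continuous_on UNIV g'"
    using assms unfolding C1_smooth_def by blast
  have "bderiv g = g'" using g'(1) bderiv_eqI by blast
  with g'(2) show ?thesis by simp
qed

lemma C1_smooth_continuous: "C1_smooth g \<Longrightarrow> continuous_on UNIV g"
  by (meson C1_smooth_has_derivative continuous_at_imp_continuous_on has_derivative_continuous)

lemma C1_smooth_const: "C1_smooth (\<lambda>x. c)"
  by (rule C1_smoothI[of _ "\<lambda>_. 0"]) (auto simp: zero_blinfun.rep_eq)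

lemma C1_smooth_blinfun: "C1_smooth (blinfun_apply T)"
  by (rule C1_smoothI[of _ "\<lambda>_. T"])
    (auto intro: bounded_linear_imp_has_derivative blinfun.bounded_linear_right)

lemma C1_smooth_add:
  assumes "C1_smooth f" "C1_smooth g"
  shows "C1_smooth (\<lambda>x. f x + g x)"
  by (rule C1_smoothI[of _ "\<lambda>x. bderiv f x + bderiv g x"])
    (auto simp: plus_blinfun.rep_eq intro!: has_derivative_add C1_smooth_has_derivative continuous_on_add
      C1_smooth_continuous_bderiv assms)

lemma C1_smooth_scaleR:
  fixes \<psi> :: "'a::real_normed_vector \<Rightarrow> real"
  assumes "C1_smooth \<psi>" "C1_smooth g"
  shows "C1_smooth (\<lambda>x. \<psi> x *\<^sub>R g x)"
proof (rule C1_smoothI)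
  show "((\<lambda>x. \<psi> x *\<^sub>R g x) has_derivative
      blinfun_apply (\<psi> x *\<^sub>R bderiv g x + (blinfun_scaleR_left (g x) o\<^sub>L bderiv \<psi> x))) (at x)" for x
    using has_derivative_scaleR[OF C1_smooth_has_derivative[OF assms(1)] C1_smooth_has_derivative[OF assms(2)], of x]
    by (simp add: plus_blinfun.rep_eq scaleR_blinfun.rep_eq)
  show "continuous_on UNIV (\<lambda>x. \<psi> x *\<^sub>R bderiv g x + (blinfun_scaleR_left (g x) o\<^sub>L bderiv \<psi> x))"
    by (intro continuous_intros C1_smooth_continuous_bderiv C1_smooth_continuous assms
        bounded_linear.continuous_on[OF bounded_linear_blinfun_scaleR_left]
        bounded_bilinear.continuous_on[OF bounded_bilinear_blinfun_compose])
qed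

lemma C1_smooth_diff:
  assumes "C1_smooth f" "C1_smooth g"
  shows "C1_smooth (\<lambda>x. f x - g x)"
  using C1_smooth_add[OF assms(1) C1_smooth_scaleR[OF C1_smooth_const[of "-1"] assms(2)]] by simp

lemma C1_smooth_compose:
  assumes "C1_smooth f" "C1_smooth g"
  shows "C1_smooth (\<lambda>x. f (g x))"
proof (rule C1_smoothI)
  show "((\<lambda>x. f (g x)) has_derivative blinfun_apply (bderiv f (g x) o\<^sub>L bderiv g x)) (at x)" for x
    using has_derivative_compose[OF C1_smooth_has_derivative[OF assms(2), of x]
        C1_smooth_has_derivative[OF assms(1), of "g x"]]
    by (simp add: blinfun_compose.rep_eq comp_def)
  show "continuous_on UNIV (\<lambda>x. bderiv f (g x) o\<^sub>L bderiv g x)"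
    by (intro bounded_bilinear.continuous_on[OF bounded_bilinear_blinfun_compose]
        C1_smooth_continuous_bderiv assms
        continuous_on_compose2[OF C1_smooth_continuous_bderiv[OF assms(1)] C1_smooth_continuous[OF assms(2)]]) auto
qed

lemma C1_smooth_sum:
  assumes "\<And>i. i \<in> I \<Longrightarrow> C1_smooth (f i)"
  shows "C1_smooth (\<lambda>x. \<Sum>i\<in>I. f i x)"
  using assms by (induction I rule: infinite_finite_induct) (auto intro: C1_smooth_const C1_smooth_add)

lemma bderiv_cong_open:
  assumes "C1_smooth h" "open U" "x \<in> U" "\<And>z. z \<in> U \<Longrightarrow> g z = h z"
  shows "bderiv g x = bderiv h x"
  using has_derivative_transform_within_open[OF C1_smooth_has_derivative[OF assms(1), of x] assms(2,3)] assms(4)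
  by (intro bderiv_eqI) auto

text \<open>
  Mappings defined by different formulas on different regions are handled through this criterion: on
  the overlaps the derivatives agree because they are determined by the values near the point.
\<close>
lemma C1_smooth_local:
  assumes "\<And>x. \<exists>U h. open U \<and> x \<in> U \<and> C1_smooth h \<and> (\<forall>z\<in>U. g z = h z)"
  shows "C1_smooth g"
proof -
  obtain U h where Uh: "\<And>x. open (U x)" "\<And>x. x \<in> U x" "\<And>x. C1_smooth (h x)" "\<And>x z. z \<in> U x \<Longrightarrow> g z = h x z"
    using assms by metis
  show ?thesis
  proof (rule C1_smoothI)
    show "(g has_derivative blinfun_apply (bderiv (h x) x)) (at x)" for x
      using has_derivative_transform_within_open[OF C1_smooth_has_derivative[OF Uh(3), of x x] Uh(1,2)] Uh(4)
      by auto
    show "continuous_on UNIV (\<lambda>x. bderiv (h x) x)"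
    proof (rule continuous_at_imp_continuous_on, rule ballI)
      fix x
      have eq: "bderiv (h x) z = bderiv (h z) z" if "z \<in> U x" for z
        using bderiv_cong_open[OF Uh(3)[of x] Uh(1)[of x] that, of g] bderiv_cong_open[OF Uh(3)[of z] Uh(1)[of z] Uh(2), of g] Uh(4)
        by auto
      have "continuous (at x) (bderiv (h x))"
        using C1_smooth_continuous_bderiv[OF Uh(3)[of x]] by (simp add: continuous_on_eq_continuous_at)
      moreover have "\<forall>\<^sub>F z in nhds x. bderiv (h x) z = bderiv (h z) z"
        using eq Uh(1,2) by (auto simp: eventually_nhds)
      ultimately show "continuous (at x) (\<lambda>z. bderiv (h z) z)"
        using isCont_cong[of "bderiv (h x)" "\<lambda>z. bderiv (h z) z" x] by blast
    qed
  qed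
qed

lemma bderiv_bound_imp_lipschitz:
  assumes "C1_smooth g" "convex S" "\<And>x. x \<in> S \<Longrightarrow> norm (bderiv g x) \<le> K" "K \<ge> 0"
  shows "K-lipschitz_on S g"
proof (rule lipschitz_onI)
  fix x y assume "x \<in> S" "y \<in> S"
  thus "dist (g x) (g y) \<le> K * dist x y"
    unfolding dist_norm
    by (intro differentiable_bound[OF assms(2), where f' = "\<lambda>x. blinfun_apply (bderiv g x)"])
      (use assms in \<open>auto simp: norm_blinfun.rep_eq intro: has_derivative_at_withinI C1_smooth_has_derivative\<close>)
qed (use assms in auto)

lemma lipschitz_imp_derivative_bound:
  assumes d: "(g has_derivative blinfun_apply T) (at x)" and L: "L-lipschitz_on U g" and U: "open U" "x \<in> U"
  shows "norm T \<le> L"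
proof (rule norm_blinfun_bound)
  show L0: "0 \<le> L" using L by (rule lipschitz_on_nonneg)
  fix h
  show "norm (T h) \<le> L * norm h"
  proof (rule field_le_epsilon)
    fix \<epsilon> :: real assume "\<epsilon> > 0"
    define e where "e = \<epsilon> / (norm h + 1)"
    have e: "e > 0" "e * norm h \<le> \<epsilon>" using \<open>\<epsilon> > 0\<close>
      by (auto simp: e_def field_simps add_pos_nonneg)
    obtain r where r: "r > 0" "ball x r \<subseteq> U" using U openE by blast
    obtain d where d: "d > 0" "\<And>y. norm (y - x) < d \<Longrightarrow> norm (g y - g x - T (y - x)) \<le> e * norm (y - x)"
      using d e(1) unfolding has_derivative_at_alt by blast
    define t where "t = min r d / (2 * (norm h + 1))"
    have t: "t > 0" using r d by (simp add: t_def add_nonneg_pos)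
    have "norm h / (2 * (norm h + 1)) < 1"
      by (simp add: pos_divide_less_eq add_nonneg_pos)
    hence "min r d * (norm h / (2 * (norm h + 1))) < min r d * 1"
      using r d by (intro mult_strict_left_mono) auto
    hence "t * norm h < min r d" by (simp add: t_def)
    hence th: "norm (x + t *\<^sub>R h - x) < min r d" using t by simp
    hence "x + t *\<^sub>R h \<in> U" using r by (auto simp: dist_norm norm_minus_commute subset_iff mem_ball)
    from lipschitz_onD[OF L this U(2)] have "norm (g (x + t *\<^sub>R h) - g x) \<le> L * (t * norm h)"
      using t by (simp add: dist_norm)
    moreover have "norm (g (x + t *\<^sub>R h) - g x - t *\<^sub>R T h) \<le> e * (t * norm h)"
      using d(2)[of "x + t *\<^sub>R h"] th t by (simp add: blinfun.scaleR_right)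
    ultimately have "norm (t *\<^sub>R T h) \<le> L * (t * norm h) + e * (t * norm h)"
      using norm_triangle_ineq4[of "g (x + t *\<^sub>R h) - g x" "g (x + t *\<^sub>R h) - g x - t *\<^sub>R T h"] by simp
    hence "t * norm (T h) \<le> t * (L * norm h + e * norm h)" using t by (simp add: algebra_simps)
    hence "norm (T h) \<le> L * norm h + e * norm h" using t by (rule mult_left_le_imp_le)
    with e(2) show "norm (T h) \<le> L * norm h + \<epsilon>" by simp
  qed
qed

lemma bderiv_add:
  assumes "C1_smooth f" "C1_smooth g"
  shows "bderiv (\<lambda>x. f x + g x) x = bderiv f x + bderiv g x"
  using has_derivative_add[OF C1_smooth_has_derivative[OF assms(1), of x] C1_smooth_has_derivative[OF assms(2), of x]]
  by (intro bderiv_eqI) (simp add: plus_blinfun.rep_eq)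

lemma bderiv_const: "bderiv (\<lambda>x. c) x = 0"
  by (intro bderiv_eqI) (simp add: zero_blinfun.rep_eq)

lemma bderiv_blinfun: "bderiv (blinfun_apply T) x = T"
  by (intro bderiv_eqI bounded_linear_imp_has_derivative blinfun.bounded_linear_right)

lemma bderiv_scaleR:
  fixes \<psi> :: "'a::real_normed_vector \<Rightarrow> real"
  assumes "C1_smooth \<psi>" "C1_smooth g"
  shows "bderiv (\<lambda>x. \<psi> x *\<^sub>R g x) x = \<psi> x *\<^sub>R bderiv g x + (blinfun_scaleR_left (g x) o\<^sub>L bderiv \<psi> x)"
  using has_derivative_scaleR[OF C1_smooth_has_derivative[OF assms(1)] C1_smooth_has_derivative[OF assms(2)], of x]
  by (intro bderiv_eqI) (simp add: plus_blinfun.rep_eq scaleR_blinfun.rep_eq)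

lemma bderiv_diff:
  assumes "C1_smooth f" "C1_smooth g"
  shows "bderiv (\<lambda>x. f x - g x) x = bderiv f x - bderiv g x"
  using has_derivative_diff[OF C1_smooth_has_derivative[OF assms(1), of x] C1_smooth_has_derivative[OF assms(2), of x]]
  by (intro bderiv_eqI) (simp add: minus_blinfun.rep_eq)

lemma bderiv_sum:
  assumes "\<And>i. i \<in> I \<Longrightarrow> C1_smooth (f i)"
  shows "bderiv (\<lambda>x. \<Sum>i\<in>I. f i x) x = (\<Sum>i\<in>I. bderiv (f i) x)"
  using assms
  by (induction I rule: infinite_finite_induct) (auto simp: bderiv_const bderiv_add C1_smooth_sum)

lemma norm_bderiv_le_lipschitz:
  assumes "C1_smooth g" "L-lipschitz_on UNIV g"
  shows "norm (bderiv g x) \<le> L"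
  using lipschitz_imp_derivative_bound[OF C1_smooth_has_derivative[OF assms(1)] assms(2)] by auto

text \<open>
  In the product rule the term with the derivative of the cut-off is small wherever the mapping that is cut off is
  small, whatever the slope \<open>\<Lambda>\<close>.  All derivative estimates for glued mappings rest on this balance.
\<close>
lemma norm_bderiv_scaleR:
  fixes \<psi> :: "'a::real_normed_vector \<Rightarrow> real"
  assumes "C1_smooth \<psi>" "C1_smooth g" "\<Lambda>-lipschitz_on UNIV \<psi>"
  shows "norm (bderiv (\<lambda>x. \<psi> x *\<^sub>R g x) x - \<psi> x *\<^sub>R bderiv g x) \<le> \<Lambda> * norm (g x)"
proof -
  have "norm (blinfun_scaleR_left (g x) o\<^sub>L bderiv \<psi> x) \<le> norm (blinfun_scaleR_left (g x)) * norm (bderiv \<psi> x)"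
    by (rule norm_blinfun_compose)
  also have "norm (blinfun_scaleR_left (g x)) \<le> norm (g x)"
    by (rule norm_blinfun_bound) (auto simp: mult.commute)
  hence "norm (blinfun_scaleR_left (g x)) * norm (bderiv \<psi> x) \<le> norm (g x) * \<Lambda>"
    by (intro mult_mono norm_bderiv_le_lipschitz assms) auto
  finally show ?thesis by (simp add: bderiv_scaleR assms(1,2) mult.commute)
qed

lemma bderiv_zero_at_min:
  fixes \<psi> :: "'a::real_normed_vector \<Rightarrow> real"
  assumes "C1_smooth \<psi>" "\<And>z. \<psi> z \<ge> 0" "\<psi> x = 0"
  shows "bderiv \<psi> x = 0"
proof -
  have "blinfun_apply (bderiv \<psi> x) = (\<lambda>h. 0)"
    by (rule has_derivative_local_min[OF C1_smooth_has_derivative[OF assms(1)]]) (use assms in auto)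
  thus ?thesis by (intro blinfun_eqI) simp
qed

section \<open>Lipschitz constants and the approximation property\<close>

lemma Lip_le:
  assumes "L-lipschitz_on A f"
  shows "Lip A f \<le> L"
proof (cases "\<exists>x\<in>A. \<exists>y\<in>A. x \<noteq> y")
  case True
  hence "Sup {norm (f x - f y) / norm (x - y) | x y. x \<in> A \<and> y \<in> A \<and> x \<noteq> y} \<le> L"
    by (intro cSup_least) (use lipschitz_on_normD[OF assms] in \<open>auto simp: divide_le_eq\<close>)
  thus ?thesis using True by (simp add: Lip_def)
qed (use lipschitz_on_nonneg[OF assms] in \<open>auto simp: Lip_def\<close>)

lemma lipschitz_on_Lip:
  assumes "lipschitz_map A f"
  shows "(Lip A f)-lipschitz_on A f"
proof (cases "\<exists>x\<in>A. \<exists>y\<in>A. x \<noteq> y")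
  case True
  obtain L where L: "L-lipschitz_on A f" using assms by (auto simp: lipschitz_map_def)
  let ?Q = "{norm (f x - f y) / norm (x - y) | x y. x \<in> A \<and> y \<in> A \<and> x \<noteq> y}"
  have "bdd_above ?Q"
    by (rule bdd_aboveI[of _ L]) (use lipschitz_on_normD[OF L] in \<open>auto simp: divide_le_eq\<close>)
  hence q: "norm (f x - f y) / norm (x - y) \<le> Lip A f" if "x \<in> A" "y \<in> A" "x \<noteq> y" for x y
    using True that by (auto simp: Lip_def intro!: cSup_upper)
  have "0 \<le> Lip A f" using True q by (meson dual_order.trans divide_nonneg_nonneg norm_ge_zero)
  moreover have "norm (f x - f y) \<le> Lip A f * norm (x - y)" if "x \<in> A" "y \<in> A" for x y
    using q[OF that] by (cases "x = y") (auto simp: divide_le_eq)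
  ultimately show ?thesis by (auto intro!: lipschitz_onI simp: dist_norm)
next
  case False
  hence "Lip A f = 0" by (simp add: Lip_def)
  thus ?thesis using False by (auto intro!: lipschitz_onI)
qed

text \<open>
  Property (*) for a fixed constant, quantified over arbitrary bounds \<open>L\<close> instead of the exact
  Lipschitz constant.
\<close>
definition C1_approximation :: "real \<Rightarrow> 'a::banach itself \<Rightarrow> 'b::banach itself \<Rightarrow> bool"
  where "C1_approximation C\<^sub>0 (_ :: 'a itself) (_ :: 'b itself) \<longleftrightarrow>
    (\<forall>(A :: 'a set) (f :: 'a \<Rightarrow> 'b) L \<epsilon>. L-lipschitz_on A f \<longrightarrow> \<epsilon> > 0 \<longrightarrow>
      (\<exists>g. C1_smooth g \<and> (C\<^sub>0 * L)-lipschitz_on UNIV g \<and> (\<forall>x\<in>A. norm (f x - g x) < \<epsilon>)))"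

lemma C1_approximationE:
  fixes f :: "'a::banach \<Rightarrow> 'b::banach"
  assumes "C1_approximation C\<^sub>0 TYPE('a) TYPE('b)" "L-lipschitz_on A f" "\<epsilon> > 0"
  obtains g where "C1_smooth g" "(C\<^sub>0 * L)-lipschitz_on UNIV g" "\<And>x. x \<in> A \<Longrightarrow> norm (f x - g x) < \<epsilon>"
  using assms unfolding C1_approximation_def by metis

lemma property_star_imp_C1_approximation:
  assumes "property_star TYPE('a::banach) TYPE('b::banach)"
  obtains C\<^sub>0 where "C\<^sub>0 \<ge> 1" "C1_approximation C\<^sub>0 TYPE('a) TYPE('b)"
proof -
  obtain C where C: "C \<ge> 1" and ex: "\<And>(A :: 'a set) (f :: 'a \<Rightarrow> 'b) \<epsilon>. \<epsilon> > 0 \<Longrightarrow> lipschitz_map A f \<Longrightarrow>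
      \<exists>g :: 'a \<Rightarrow> 'b. C1_smooth g \<and> lipschitz_map UNIV g \<and>
        (\<forall>x\<in>A. norm (f x - g x) < \<epsilon>) \<and> Lip UNIV g \<le> C * Lip A f"
    using assms unfolding property_star_def by blast
  have "\<exists>g. C1_smooth g \<and> (C * L)-lipschitz_on UNIV g \<and> (\<forall>x\<in>A. norm (f x - g x) < \<epsilon>)"
    if L: "L-lipschitz_on A f" and \<epsilon>: "\<epsilon> > 0" for A :: "'a set" and f :: "'a \<Rightarrow> 'b" and L \<epsilon>
  proof -
    have "lipschitz_map A f" using L by (auto simp: lipschitz_map_def)
    from ex[OF \<epsilon> this] obtain g where g: "C1_smooth g" "lipschitz_map UNIV g"
      "\<forall>x\<in>A. norm (f x - g x) < \<epsilon>" "Lip UNIV g \<le> C * Lip A f" by blast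
    have "Lip UNIV g \<le> C * L" using g(4) mult_left_mono[OF Lip_le[OF L], of C] C by linarith
    with g show ?thesis using lipschitz_on_Lip[OF g(2)] lipschitz_on_le by blast
  qed
  with C show ?thesis by (intro that[of C]) (auto simp: C1_approximation_def)
qed

section \<open>Smooth bumps\<close>

lemma C1_smooth_real:
  assumes "\<And>x. (f has_real_derivative f' x) (at x)" "continuous_on UNIV f'"
  shows "C1_smooth (f :: real \<Rightarrow> real)"
proof (rule C1_smoothI)
  show "(f has_derivative blinfun_apply (blinfun_scaleR_left (f' x))) (at x)" for x
  proof -
    have "blinfun_apply (blinfun_scaleR_left (f' x)) = (*) (f' x)"
      by (auto simp: fun_eq_iff blinfun_scaleR_left.rep_eq)
    thus ?thesis using assms(1)[of x] by (simp add: has_field_derivative_def)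
  qed
  show "continuous_on UNIV (\<lambda>x. blinfun_scaleR_left (f' x))"
    by (intro bounded_linear.continuous_on[OF bounded_linear_blinfun_scaleR_left] assms)
qed

lemma positive_part_square_derivative:
  "((\<lambda>t. (max 0 (t - c))\<^sup>2) has_real_derivative 2 * max 0 (t - c)) (at (t :: real))"
proof -
  consider "t < c" | "t = c" | "t > c" by linarith
  thus ?thesis
  proof cases
    case 1
    have "((\<lambda>t. 0 :: real) has_real_derivative 0) (at t)" by simp
    from has_field_derivative_transform_within_open[OF this, of "{..<c}" "\<lambda>t. (max 0 (t - c))\<^sup>2"] 1
    show ?thesis by (simp add: max_def)
  next
    case 3
    have "((\<lambda>t. (t - c)\<^sup>2) has_real_derivative 2 * (t - c)) (at t)"
      by (auto intro!: derivative_eq_intros)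
    from has_field_derivative_transform_within_open[OF this, of "{c<..}" "\<lambda>t. (max 0 (t - c))\<^sup>2"] 3
    show ?thesis by (simp add: max_def)
  next
    case 2
    have "((\<lambda>h. (max 0 h)\<^sup>2 / h) \<longlongrightarrow> 0) (at (0 :: real))"
    proof (rule Lim_null_comparison)
      show "\<forall>\<^sub>F h in at 0. norm ((max 0 h)\<^sup>2 / h) \<le> \<bar>h :: real\<bar>"
        by (auto simp: power2_eq_square max_def)
      show "((\<lambda>h. \<bar>h\<bar>) \<longlongrightarrow> 0) (at (0 :: real))" by (rule tendsto_eq_intros | simp)+
    qed
    with 2 show ?thesis by (simp add: DERIV_def)
  qed
qed

text \<open>
  The derivative of the step is a tent function with support \<open>[0, 1]\<close>, which is a second difference of
  positive parts; the step is the corresponding second difference of their squares.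
\<close>
lemma smooth_step:
  "\<exists>\<sigma> :: real \<Rightarrow> real. C1_smooth \<sigma> \<and> 2-lipschitz_on UNIV \<sigma> \<and>
    (\<forall>t. 0 \<le> \<sigma> t \<and> \<sigma> t \<le> 1 \<and> (t \<le> 0 \<longrightarrow> \<sigma> t = 0) \<and> (t \<ge> 1 \<longrightarrow> \<sigma> t = 1))"
proof -
  define p where "p = (\<lambda>c t :: real. (max 0 (t - c))\<^sup>2)"
  define \<sigma> where "\<sigma> = (\<lambda>t. 2 * (p 0 t - 2 * p (1/2) t + p 1 t))"
  define \<sigma>' where "\<sigma>' = (\<lambda>t :: real. 4 * (max 0 (t - 0) - 2 * max 0 (t - 1/2) + max 0 (t - 1)))"
  have p: "(p c has_real_derivative 2 * max 0 (t - c)) (at t)" for c t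
    unfolding p_def by (rule positive_part_square_derivative)
  have d: "(\<sigma> has_real_derivative \<sigma>' t) (at t)" for t
    unfolding \<sigma>_def \<sigma>'_def by (auto intro!: derivative_eq_intros p)
  have c: "continuous_on UNIV \<sigma>'" unfolding \<sigma>'_def by (intro continuous_intros)
  have b: "\<bar>\<sigma>' t\<bar> \<le> 2" for t unfolding \<sigma>'_def by (auto simp: max_def)
  have lip: "2-lipschitz_on UNIV \<sigma>"
    by (rule lipschitz_onI) (use field_differentiable_bound[of UNIV \<sigma> \<sigma>' 2] d b in \<open>auto simp: dist_norm\<close>)
  have low: "\<sigma> t = 0" if "t \<le> 0" for t using that by (simp add: \<sigma>_def p_def max_def)
  have high: "\<sigma> t = 1" if "t \<ge> 1" for t
    using that by (simp add: \<sigma>_def p_def max_def power2_eq_square algebra_simps)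
  have "\<sigma>' t \<ge> 0" for t unfolding \<sigma>'_def by (auto simp: max_def)
  hence mono: "\<sigma> s \<le> \<sigma> t" if "s \<le> t" for s t
    using DERIV_nonneg_imp_nondecreasing[OF that, of \<sigma>] d by blast
  have "0 \<le> \<sigma> t" "\<sigma> t \<le> 1" for t
    using low[of "min t 0"] mono[of "min t 0" t] high[of "max t 1"] mono[of t "max t 1"] by auto
  with lip low high C1_smooth_real[OF d c] show ?thesis by (intro exI[of _ \<sigma>]) simp
qed

text \<open>
  A scalar function times the fixed vector \<open>e\<close> is approximated in the target space, and a functional
  with value \<open>1\<close> at \<open>e\<close> recovers a scalar approximation.
\<close>
lemma C1_approximation_scalar:
  assumes "C1_approximation C\<^sub>0 TYPE('a::banach) TYPE('b::banach)" "C\<^sub>0 \<ge> 1" "(e :: 'b) \<noteq> 0"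
  obtains K where "K > 0" "C1_approximation K TYPE('a) TYPE(real)"
proof -
  obtain \<phi> :: "'b \<Rightarrow>\<^sub>L real" where \<phi>: "blinfun_apply \<phi> e = 1" using norming_functional[OF assms(3)] .
  have \<phi>0: "norm \<phi> > 0" using \<phi> by auto
  define K where "K = norm \<phi> * C\<^sub>0 * norm e"
  have "\<exists>v. C1_smooth v \<and> (K * L)-lipschitz_on UNIV v \<and> (\<forall>x\<in>A. norm (u x - v x) < \<epsilon>)"
    if L: "L-lipschitz_on A u" and \<epsilon>: "\<epsilon> > 0" for A :: "'a set" and u :: "'a \<Rightarrow> real" and L \<epsilon>
  proof -
    have "(norm e * L)-lipschitz_on A (\<lambda>x. u x *\<^sub>R e)"
    proof (rule lipschitz_onI)
      fix x y assume "x \<in> A" "y \<in> A"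
      from lipschitz_onD[OF L this] show "dist (u x *\<^sub>R e) (u y *\<^sub>R e) \<le> norm e * L * dist x y"
        by (simp add: dist_norm mult_left_mono mult.assoc flip: scaleR_diff_left)
          (metis mult.commute mult_left_mono norm_ge_zero)
    qed (use lipschitz_on_nonneg[OF L] in auto)
    then obtain g where g: "C1_smooth g" "(C\<^sub>0 * (norm e * L))-lipschitz_on UNIV g"
      "\<And>x. x \<in> A \<Longrightarrow> norm (u x *\<^sub>R e - g x) < \<epsilon> / norm \<phi>"
      using C1_approximationE[OF assms(1), of "norm e * L" A "\<lambda>x. u x *\<^sub>R e" "\<epsilon> / norm \<phi>"] \<epsilon> \<phi>0 by auto
    have "(norm \<phi> * (C\<^sub>0 * (norm e * L)))-lipschitz_on UNIV (\<lambda>x. \<phi> (g x))"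
    proof (rule lipschitz_onI)
      fix x y
      show "dist (\<phi> (g x)) (\<phi> (g y)) \<le> norm \<phi> * (C\<^sub>0 * (norm e * L)) * dist x y"
        using norm_blinfun[of \<phi> "g x - g y"] mult_left_mono[OF lipschitz_onD[OF g(2), of x y], of "norm \<phi>"]
        by (simp add: dist_norm blinfun.diff_right mult.assoc)
    qed (use lipschitz_on_nonneg[OF g(2)] in auto)
    moreover have "norm (u x - \<phi> (g x)) < \<epsilon>" if "x \<in> A" for x
    proof -
      have "u x - \<phi> (g x) = \<phi> (u x *\<^sub>R e - g x)" by (simp add: blinfun.diff_right blinfun.scaleR_right \<phi>)
      hence "norm (u x - \<phi> (g x)) \<le> norm \<phi> * norm (u x *\<^sub>R e - g x)" by (metis norm_blinfun)
      also have "\<dots> < norm \<phi> * (\<epsilon> / norm \<phi>)" using g(3)[OF that] \<phi>0 by (intro mult_strict_left_mono)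
      finally show ?thesis using \<phi>0 by simp
    qed
    moreover have "C1_smooth (\<lambda>x. \<phi> (g x))" by (rule C1_smooth_compose[OF C1_smooth_blinfun g(1)])
    ultimately show ?thesis by (auto simp: K_def mult.assoc)
  qed
  moreover have "K > 0" using \<phi>0 assms by (simp add: K_def)
  ultimately show ?thesis by (intro that[of K]) (auto simp: C1_approximation_def)
qed

text \<open>
  The constant \<open>K\<close> is to be independent of \<open>S\<close> and of the scale \<open>d\<close>.  The conditions are stated
  pointwise instead of by means of the distance to \<open>S\<close>, so that they are meaningful for empty \<open>S\<close>.
\<close>
definition smooth_bump :: "real \<Rightarrow> 'a::real_normed_vector set \<Rightarrow> real \<Rightarrow> ('a \<Rightarrow> real) \<Rightarrow> bool"
  where "smooth_bump K S d w \<longleftrightarrow> C1_smooth w \<and> (K / d)-lipschitz_on UNIV w \<and> (\<forall>x. w x \<in> {0..1}) \<and>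
    (\<forall>x. \<forall>s\<in>S. dist x s \<le> d \<longrightarrow> w x = 1) \<and> (\<forall>x. (\<forall>s\<in>S. 2 * d \<le> dist x s) \<longrightarrow> w x = 0)"

lemma smooth_bump_exists:
  assumes "C1_approximation C TYPE('a::banach) TYPE(real)" "C > 0"
  shows "\<exists>K>0. \<forall>(S :: 'a set) d. d > 0 \<longrightarrow> (\<exists>w. smooth_bump K S d w)"
proof (intro exI[of _ "4 * C"] conjI allI impI)
  fix S :: "'a set" and d :: real assume d: "d > 0"
  show "\<exists>w. smooth_bump (4 * C) S d w"
  proof (cases "S = {}")
    case True
    have "smooth_bump (4 * C) S d (\<lambda>x. 0)" unfolding smooth_bump_def True
      using d assms(2) by (auto intro!: C1_smooth_const lipschitz_onI)
    thus ?thesis by blast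
  next
    case ne: False
    \<comment> \<open>The distance function is smoothed with error \<open>d / 4\<close>, so the level \<open>d\<close> stays below \<open>5 d / 4\<close> and
      the level \<open>2 d\<close> above \<open>7 d / 4\<close>; the step descends between these two values.\<close>
    have "1-lipschitz_on UNIV (\<lambda>x. infdist x S)"
      by (rule lipschitz_onI) (auto simp: dist_real_def infdist_triangle_abs)
    then obtain v where v: "C1_smooth v" "C-lipschitz_on UNIV v" "\<And>x. \<bar>infdist x S - v x\<bar> < d / 4"
      using C1_approximationE[OF assms(1), of 1 UNIV "\<lambda>x. infdist x S" "d/4"] d by auto
    obtain \<sigma> :: "real \<Rightarrow> real" where step: "C1_smooth \<sigma> \<and> 2-lipschitz_on UNIV \<sigma> \<and>
        (\<forall>t. 0 \<le> \<sigma> t \<and> \<sigma> t \<le> 1 \<and> (t \<le> 0 \<longrightarrow> \<sigma> t = 0) \<and> (t \<ge> 1 \<longrightarrow> \<sigma> t = 1))"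
      using smooth_step by (rule exE)
    have \<sigma>: "C1_smooth \<sigma>" "2-lipschitz_on UNIV \<sigma>" "\<And>t. 0 \<le> \<sigma> t" "\<And>t. \<sigma> t \<le> 1"
      "\<And>t. t \<le> 0 \<Longrightarrow> \<sigma> t = 0" "\<And>t. t \<ge> 1 \<Longrightarrow> \<sigma> t = 1"
      using step by simp_all
    define w where "w x = 1 - \<sigma> ((2 / d) *\<^sub>R v x - 5 / 2)" for x
    have "C1_smooth w" unfolding w_def
      by (intro C1_smooth_diff C1_smooth_const C1_smooth_compose[OF \<sigma>(1)] C1_smooth_scaleR v)
    moreover have "(4 * C / d)-lipschitz_on UNIV w"
    proof (rule lipschitz_onI)
      fix x y
      have "dist (w x) (w y) \<le> 2 * dist ((2 / d) *\<^sub>R v x - 5 / 2) ((2 / d) *\<^sub>R v y - 5 / 2)"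
        using lipschitz_onD[OF \<sigma>(2), of "(2 / d) *\<^sub>R v x - 5 / 2" "(2 / d) *\<^sub>R v y - 5 / 2"]
        by (simp add: w_def dist_real_def)
      also have "(2 / d) *\<^sub>R v x - 5 / 2 - ((2 / d) *\<^sub>R v y - 5 / 2) = 2 / d * (v x - v y)"
        using d by (simp add: field_simps)
      hence "2 * dist ((2 / d) *\<^sub>R v x - 5 / 2) ((2 / d) *\<^sub>R v y - 5 / 2) = 4 / d * dist (v x) (v y)"
        using d by (simp only: dist_real_def abs_mult) simp
      also have "\<dots> \<le> 4 / d * (C * dist x y)"
        using lipschitz_onD[OF v(2), of x y] d by (intro mult_left_mono) auto
      finally show "dist (w x) (w y) \<le> 4 * C / d * dist x y" by simp
    qed (use d assms in auto)
    moreover have "w x \<in> {0..1}" for x using \<sigma>(3,4) by (simp add: w_def)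
    moreover have "w x = 1" if "s \<in> S" "dist x s \<le> d" for x s
    proof -
      have "v x \<le> 5 * d / 4" using v(3)[of x] infdist_le[OF that(1), of x] that(2) by linarith
      hence "(2 / d) *\<^sub>R v x - 5 / 2 \<le> 0" using d by (simp add: field_simps)
      thus ?thesis using \<sigma>(5) by (simp add: w_def)
    qed
    moreover have "w x = 0" if "\<And>s. s \<in> S \<Longrightarrow> 2 * d \<le> dist x s" for x
    proof -
      have "2 * d \<le> infdist x S" unfolding infdist_notempty[OF ne] using ne that by (intro cINF_greatest)
      hence "v x \<ge> 7 * d / 4" using v(3)[of x] by linarith
      hence "(2 / d) *\<^sub>R v x - 5 / 2 \<ge> 1" using d by (simp add: field_simps)
      thus ?thesis using \<sigma>(6) by (simp add: w_def)
    qed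
    ultimately have "smooth_bump (4 * C) S d w"
      unfolding smooth_bump_def by (intro conjI allI ballI impI) simp_all
    thus ?thesis by (rule exI[of _ w])
  qed
qed (use assms in auto)

section \<open>From extension to approximation\<close>

lemma maximal_separated_subset:
  fixes A :: "'a::metric_space set"
  obtains N where "N \<subseteq> A" "\<And>x y. x \<in> N \<Longrightarrow> y \<in> N \<Longrightarrow> dist x y < \<delta> \<Longrightarrow> x = y"
    "\<And>x. x \<in> A \<Longrightarrow> \<exists>y\<in>N. dist x y < \<delta> \<or> x = y"
proof -
  define \<S> where "\<S> = {N. N \<subseteq> A \<and> (\<forall>x\<in>N. \<forall>y\<in>N. dist x y < \<delta> \<longrightarrow> x = y)}"
  have "\<exists>M\<in>\<S>. \<forall>X\<in>\<S>. M \<subseteq> X \<longrightarrow> X = M"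
  proof (rule subset_Zorn')
    fix C assume C: "subset.chain \<S> C"
    show "\<Union>C \<in> \<S>"
      unfolding \<S>_def
    proof (safe)
      show "x \<in> A" if "x \<in> X" "X \<in> C" for x X using C that by (auto simp: subset.chain_def \<S>_def)
      fix x y X Y assume *: "x \<in> X" "X \<in> C" "y \<in> Y" "Y \<in> C" "dist x y < \<delta>"
      hence "X \<subseteq> Y \<or> Y \<subseteq> X" using C by (auto simp: subset.chain_def)
      moreover have "X \<in> \<S>" "Y \<in> \<S>" using C * by (auto simp: subset.chain_def)
      ultimately show "x = y" using * by (auto simp: \<S>_def)
    qed
  qed
  then obtain N where N: "N \<in> \<S>" and max: "\<And>X. X \<in> \<S> \<Longrightarrow> N \<subseteq> X \<Longrightarrow> X = N" by blast
  have "\<exists>y\<in>N. dist x y < \<delta> \<or> x = y" if "x \<in> A" for x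
  proof (rule ccontr)
    assume *: "\<not> ?thesis"
    hence "insert x N \<in> \<S>" using N that unfolding \<S>_def by (auto simp: dist_commute)
    from max[OF this] * show False by blast
  qed
  with N show ?thesis by (intro that[of N]) (auto simp: \<S>_def)
qed

text \<open>
  On a uniformly discrete set the mean value condition holds for the zero operator, whence the
  bound \<open>C (M + Lip f)\<close> reduces to \<open>C Lip f\<close>.
\<close>
lemma extension_imp_property_star:
  assumes "C1_Lipschitz_extension_property TYPE('a::banach) TYPE('b::banach)"
  shows "property_star TYPE('a) TYPE('b)"
proof -
  obtain C where C: "C \<ge> 1" and ext: "\<And>(A :: 'a set) (f :: 'a \<Rightarrow> 'b) D. closed A \<Longrightarrow> lipschitz_map A f \<Longrightarrow>
      mean_value_condition_bounded A f D \<Longrightarrow>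
      \<exists>G. C1_smooth G \<and> lipschitz_map UNIV G \<and> (\<forall>x\<in>A. G x = f x) \<and> Lip UNIV G \<le> C * (sup_norm A D + Lip A f)"
    using assms unfolding C1_Lipschitz_extension_property_def by blast
  have "\<exists>g. C1_smooth g \<and> lipschitz_map UNIV g \<and> (\<forall>x\<in>A. norm (f x - g x) < \<epsilon>) \<and> Lip UNIV g \<le> C * Lip A f"
    if \<epsilon>: "\<epsilon> > 0" and f: "lipschitz_map A f" for A :: "'a set" and f :: "'a \<Rightarrow> 'b" and \<epsilon>
  proof -
    define L where "L = Lip A f"
    have L: "L-lipschitz_on A f" unfolding L_def by (rule lipschitz_on_Lip[OF f])
    have L0: "L \<ge> 0" using L by (rule lipschitz_on_nonneg)
    define \<delta> where "\<delta> = \<epsilon> / ((1 + C) * L + 1)"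
    have \<delta>: "\<delta> > 0" using \<epsilon> L0 C by (auto simp: \<delta>_def intro!: divide_pos_pos add_nonneg_pos)
    have \<delta>\<epsilon>: "(1 + C) * L * \<delta> < \<epsilon>"
    proof -
      have "\<delta> * ((1 + C) * L + 1) = \<epsilon>" using L0 C by (simp add: \<delta>_def add_nonneg_pos order_less_imp_not_eq2)
      thus ?thesis using \<delta> by (simp add: algebra_simps)
    qed
    obtain N where N: "N \<subseteq> A" "\<And>x y. x \<in> N \<Longrightarrow> y \<in> N \<Longrightarrow> dist x y < \<delta> \<Longrightarrow> x = y"
      "\<And>x. x \<in> A \<Longrightarrow> \<exists>y\<in>N. dist x y < \<delta> \<or> x = y"
      using maximal_separated_subset[of A \<delta>] by blast
    have "closed N" by (rule discrete_imp_closed[OF \<delta>]) (use N(2) in blast)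
    moreover have LN: "L-lipschitz_on N f" using L N(1) by (rule lipschitz_on_subset)
    moreover have "mean_value_condition_bounded N f (\<lambda>_. 0)"
      unfolding mean_value_condition_bounded_def
    proof (intro conjI ballI allI impI)
      fix y \<eta> assume "y \<in> N"
      have *: "z = y" if "z \<in> N \<inter> ball y \<delta>" for z using N(2)[of y z] that \<open>y \<in> N\<close> by auto
      thus "\<exists>r>0. \<forall>z\<in>N \<inter> ball y r. \<forall>w\<in>N \<inter> ball y r. norm (f z - f w - blinfun_apply 0 (z - w)) \<le> \<eta> * norm (z - w)"
      proof (intro exI[of _ \<delta>] conjI ballI \<delta>)
        fix z w assume "z \<in> N \<inter> ball y \<delta>" "w \<in> N \<inter> ball y \<delta>"
        hence "z = y" "w = y" using * by blast+
        thus "norm (f z - f w - blinfun_apply 0 (z - w)) \<le> \<eta> * norm (z - w)" by simp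
      qed
    qed auto
    ultimately obtain G where G: "C1_smooth G" "lipschitz_map UNIV G" "\<And>x. x \<in> N \<Longrightarrow> G x = f x"
      "Lip UNIV G \<le> C * (sup_norm N (\<lambda>_. 0 :: 'a \<Rightarrow>\<^sub>L 'b) + Lip N f)"
      using ext[of N f "\<lambda>_. 0"] by (auto simp: lipschitz_map_def)
    have "Lip UNIV G \<le> C * Lip N f" using G(4) by (simp add: sup_norm_def split: if_splits)
    also have "\<dots> \<le> C * L" using C Lip_le[OF LN] by simp
    finally have GL: "Lip UNIV G \<le> C * L" .
    have GL': "(C * L)-lipschitz_on UNIV G" using lipschitz_on_Lip[OF G(2)] GL lipschitz_on_le by blast
    have "norm (f x - G x) < \<epsilon>" if x: "x \<in> A" for x
    proof -
      obtain y where y: "y \<in> N" "dist x y < \<delta> \<or> x = y" using N(3)[OF x] by blast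
      have "norm (f x - f y) \<le> L * norm (x - y)" using lipschitz_on_normD[OF L x] y(1) N(1) by blast
      moreover have "norm (G y - G x) \<le> C * L * norm (y - x)" using lipschitz_on_normD[OF GL'] by blast
      ultimately have "norm (f x - G x) \<le> (1 + C) * L * norm (x - y)"
        using norm_triangle_ineq[of "f x - f y" "G y - G x"] G(3)[OF y(1)]
        by (simp add: norm_minus_commute algebra_simps)
      also have "\<dots> \<le> (1 + C) * L * \<delta>"
        using y(2) L0 C \<delta> by (intro mult_left_mono) (auto simp: dist_norm)
      finally show ?thesis using \<delta>\<epsilon> by simp
    qed
    with G GL show ?thesis unfolding L_def by blast
  qed
  with C show ?thesis unfolding property_star_def by blast
qed

section \<open>Partitions of unity with discrete layers\<close>

text \<open>
  Label each point by the least index, in some well-order, of a set of the cover containing it.  If two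
  points lie in the sets selected by each other, neither label can be smaller than the other one.
\<close>
lemma least_index_labelling:
  fixes U :: "'i \<Rightarrow> 'a set"
  shows "\<exists>m. (\<forall>x\<in>\<Union>(U ` I). m x \<in> I \<and> x \<in> U (m x)) \<and>
    (\<forall>x\<in>\<Union>(U ` I). \<forall>x'\<in>\<Union>(U ` I). x \<in> U (m x') \<longrightarrow> x' \<in> U (m x) \<longrightarrow> m x = m x')"
proof -
  obtain r :: "'i rel" where r: "Well_order r" "Field r = UNIV" using well_ordering by (elim exE conjE)
  have wf: "wf (r - Id)" using r by (simp add: well_order_on_def)
  have "total_on UNIV r" using r unfolding well_order_on_def linear_order_on_def by metis
  hence tot: "(i, j) \<in> r - Id \<or> (j, i) \<in> r - Id" if "i \<noteq> j" for i j
    using that unfolding total_on_def by blast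
  have "\<exists>i. i \<in> I \<and> x \<in> U i \<and> (\<forall>j. (j, i) \<in> r - Id \<longrightarrow> \<not> (j \<in> I \<and> x \<in> U j))"
    if x: "x \<in> \<Union>(U ` I)" for x
  proof -
    obtain i where "i \<in> {i \<in> I. x \<in> U i}" using x by blast
    from wfE_min[OF wf this] obtain z where z: "z \<in> {i \<in> I. x \<in> U i}"
      "\<And>j. (j, z) \<in> r - Id \<Longrightarrow> j \<notin> {i \<in> I. x \<in> U i}" by metis
    thus ?thesis by (intro exI[of _ z]) simp
  qed
  then obtain m where m: "\<forall>x\<in>\<Union>(U ` I). m x \<in> I \<and> x \<in> U (m x) \<and>
      (\<forall>j. (j, m x) \<in> r - Id \<longrightarrow> \<not> (j \<in> I \<and> x \<in> U j))"
    using bchoice[of "\<Union>(U ` I)" "\<lambda>x i. i \<in> I \<and> x \<in> U i \<and> (\<forall>j. (j, i) \<in> r - Id \<longrightarrow> \<not> (j \<in> I \<and> x \<in> U j))"]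
    by auto
  have "m x = m x'" if "x \<in> \<Union>(U ` I)" "x' \<in> \<Union>(U ` I)" "x \<in> U (m x')" "x' \<in> U (m x)" for x x'
  proof (rule ccontr)
    assume "m x \<noteq> m x'"
    hence "(m x, m x') \<in> r - Id \<or> (m x', m x) \<in> r - Id" by (rule tot)
    thus False using bspec[OF m that(1)] bspec[OF m that(2)] that(3,4) by metis
  qed
  with m show ?thesis by (intro exI[of _ m] conjI ballI impI) metis+
qed

text \<open>
  Around every point either \<open>w\<close> vanishes or a single index is selected, and in the latter case this
  happens on a ball of radius \<open>t\<close> not depending on the point.  Thus the pieces of the support of \<open>w\<close> on
  which different indices are selected are uniformly separated.
\<close>
definition layer :: "'i set \<Rightarrow> ('i \<Rightarrow> 'a::metric_space set) \<Rightarrow> ('a \<Rightarrow> real) \<Rightarrow> ('a \<Rightarrow> 'i) \<Rightarrow> real \<Rightarrow> bool"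
  where "layer I U w lab t \<longleftrightarrow> t > 0 \<and> (\<forall>x. (\<exists>r>0. \<forall>z\<in>ball x r. w z = 0) \<or>
    (\<exists>i\<in>I. ball x t \<subseteq> U i \<and> (\<forall>z\<in>ball x t. lab z = i)))"

text \<open>
  Points whose \<open>\<delta>\<close>-ball is contained in the set selected by their label form a set \<open>S\<close> in which different labels
  occur only at distance at least \<open>\<delta>\<close>.  A bump for \<open>S\<close> at a much smaller scale therefore has a
  support which falls apart into separated pieces, one for each label.
\<close>
lemma single_layer:
  fixes U :: "'i \<Rightarrow> 'a::real_normed_vector set"
  assumes bump: "\<And>(S :: 'a set) d. d > 0 \<Longrightarrow> \<exists>w. smooth_bump K S d w"
    and m: "\<And>x. x \<in> \<Union>(U ` I) \<Longrightarrow> m x \<in> I"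
    and disc: "\<And>x x'. x \<in> \<Union>(U ` I) \<Longrightarrow> x' \<in> \<Union>(U ` I) \<Longrightarrow> x \<in> U (m x') \<Longrightarrow> x' \<in> U (m x) \<Longrightarrow> m x = m x'"
    and \<delta>: "\<delta> > 0"
  shows "\<exists>w lab t. C1_smooth w \<and> (\<exists>L. L-lipschitz_on UNIV w) \<and> (\<forall>x. w x \<in> {0..1}) \<and> layer I U w lab t \<and>
    (\<forall>x\<in>\<Union>(U ` I). ball x \<delta> \<subseteq> U (m x) \<longrightarrow> (\<exists>r>0. \<forall>z\<in>ball x r. w z = 1))"
proof -
  define S where "S = {x \<in> \<Union>(U ` I). ball x \<delta> \<subseteq> U (m x)}"
  obtain w where w: "smooth_bump K S (\<delta> / 16) w" using bump[of "\<delta> / 16" S] \<delta> by auto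
  \<comment> \<open>Points of \<open>S\<close> at distance less than \<open>\<delta> / 2\<close> from \<open>z\<close> are less than \<open>\<delta>\<close> apart and carry the same
    label, so the choice does not matter.  If there is none, the label is arbitrary and \<open>w\<close> vanishes.\<close>
  define s where "s z = (SOME s. s \<in> S \<and> dist s z < \<delta> / 2)" for z
  have same: "m (s z) = m a" if "a \<in> S" "dist a z < \<delta> / 2" for a z
  proof -
    have s: "s z \<in> S" "dist (s z) z < \<delta> / 2"
      using someI[of "\<lambda>s. s \<in> S \<and> dist s z < \<delta> / 2" a] that unfolding s_def by blast+
    have "dist a (s z) \<le> dist a z + dist (s z) z" by (metis dist_commute dist_triangle)
    hence "dist a (s z) < \<delta>" using s(2) that(2) by linarith
    thus ?thesis using s(1) that(1) disc[of "s z" a] by (auto simp: S_def subset_iff dist_commute)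
  qed
  have "(\<exists>r>0. \<forall>z\<in>ball x r. w z = 0) \<or>
      (\<exists>i\<in>I. ball x (\<delta> / 4) \<subseteq> U i \<and> (\<forall>z\<in>ball x (\<delta> / 4). m (s z) = i))" for x
  proof (cases "\<exists>a\<in>S. dist x a < \<delta> / 4")
    case True
    then obtain a where a: "a \<in> S" "dist x a < \<delta> / 4" by blast
    have near: "dist a z < \<delta> / 2" if "z \<in> ball x (\<delta> / 4)" for z
      using that a(2) dist_triangle[of a z x] by (simp add: dist_commute)
    have "ball x (\<delta> / 4) \<subseteq> ball a \<delta>" using near \<delta> by (auto simp: subset_iff) (smt (verit) mem_ball near)
    hence "ball x (\<delta> / 4) \<subseteq> U (m a)" using a(1) by (auto simp: S_def)
    moreover have "m a \<in> I" using a(1) m by (auto simp: S_def)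
    ultimately show ?thesis using same[OF a(1) near] by blast
  next
    case False
    have "w z = 0" if z: "z \<in> ball x (\<delta> / 8)" for z
    proof -
      have "2 * (\<delta> / 16) \<le> dist z a" if "a \<in> S" for a
      proof -
        have "\<delta> / 4 \<le> dist x a" using False that by force
        moreover have "dist x a \<le> dist x z + dist z a" by (rule dist_triangle)
        ultimately show ?thesis using z by simp
      qed
      thus ?thesis using w unfolding smooth_bump_def by blast
    qed
    thus ?thesis using \<delta> by (intro disjI1 exI[of _ "\<delta> / 8"]) auto
  qed
  hence "layer I U w (\<lambda>z. m (s z)) (\<delta> / 4)" using \<delta> by (simp add: layer_def)
  moreover have "\<exists>r>0. \<forall>z\<in>ball x r. w z = 1" if "x \<in> \<Union>(U ` I)" "ball x \<delta> \<subseteq> U (m x)" for x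
  proof (intro exI[of _ "\<delta> / 16"] conjI ballI)
    fix z assume "z \<in> ball x (\<delta> / 16)"
    hence "dist z x \<le> \<delta> / 16" by (simp add: dist_commute)
    moreover have "x \<in> S" using that by (simp add: S_def)
    ultimately show "w z = 1" using w unfolding smooth_bump_def by blast
  qed (use \<delta> in auto)
  ultimately show ?thesis using w unfolding smooth_bump_def by blast
qed

lemma lipschitz_on_mult_unit:
  fixes u v :: "'a::metric_space \<Rightarrow> real"
  assumes u: "L-lipschitz_on UNIV u" "\<And>x. u x \<in> {0..1}" and v: "M-lipschitz_on UNIV v" "\<And>x. v x \<in> {0..1}"
  shows "(L + M)-lipschitz_on UNIV (\<lambda>x. u x * v x)"
proof (rule lipschitz_onI)
  fix x y
  have "u x * v x - u y * v y = (u x - u y) * v x + u y * (v x - v y)" by (simp add: algebra_simps)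
  hence "\<bar>u x * v x - u y * v y\<bar> \<le> \<bar>u x - u y\<bar> * \<bar>v x\<bar> + \<bar>u y\<bar> * \<bar>v x - v y\<bar>"
    by (metis abs_mult abs_triangle_ineq)
  also have "\<dots> \<le> \<bar>u x - u y\<bar> * 1 + 1 * \<bar>v x - v y\<bar>"
    using u(2)[of y] v(2)[of x] by (intro add_mono mult_mono) auto
  also have "\<dots> \<le> L * dist x y + M * dist x y"
    using lipschitz_onD[OF u(1), of x y] lipschitz_onD[OF v(1), of x y] by (simp add: dist_real_def)
  finally show "dist (u x * v x) (u y * v y) \<le> (L + M) * dist x y" by (simp add: dist_real_def algebra_simps)
qed (use lipschitz_on_nonneg[OF u(1)] lipschitz_on_nonneg[OF v(1)] in auto)

text \<open>
  Every point of the union lies in the set of the layer of scale \<open>(1/2) ^ k\<close> for all large \<open>k\<close>.  The usual product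
  trick \<open>\<psi> k = w k * (1 - w 0) * \<dots> * (1 - w (k - 1))\<close> makes the partial sums equal to \<open>1\<close>
  near each point of the union from some index on.
\<close>
lemma layered_partition_of_unity:
  fixes U :: "'i \<Rightarrow> 'a::real_normed_vector set"
  assumes bump: "\<And>(S :: 'a set) d. d > 0 \<Longrightarrow> \<exists>w. smooth_bump K S d w"
    and opn: "\<And>i. i \<in> I \<Longrightarrow> open (U i)"
  obtains \<psi> :: "nat \<Rightarrow> 'a \<Rightarrow> real" and lab :: "nat \<Rightarrow> 'a \<Rightarrow> 'i" and t \<Lambda> where "\<And>k. C1_smooth (\<psi> k)" "\<And>k. (\<Lambda> k)-lipschitz_on UNIV (\<psi> k)"
    "\<And>k x. \<psi> k x \<ge> 0" "\<And>n x. (\<Sum>k<n. \<psi> k x) \<le> 1" "\<And>k. layer I U (\<psi> k) (lab k) (t k)"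
    "\<And>x. x \<in> \<Union>(U ` I) \<Longrightarrow> \<exists>N. \<exists>r>0. \<forall>n\<ge>N. \<forall>z\<in>ball x r. (\<Sum>k<n. \<psi> k z) = 1"
proof -
  obtain m where labelling: "(\<forall>x\<in>\<Union>(U ` I). m x \<in> I \<and> x \<in> U (m x)) \<and>
    (\<forall>x\<in>\<Union>(U ` I). \<forall>x'\<in>\<Union>(U ` I). x \<in> U (m x') \<longrightarrow> x' \<in> U (m x) \<longrightarrow> m x = m x')"
    using least_index_labelling[of U I] by (rule exE)
  have m: "m x \<in> I" "x \<in> U (m x)" if "x \<in> \<Union>(U ` I)" for x
    using bspec[OF conjunct1[OF labelling] that] by auto
  have disc: "m x = m x'" if "x \<in> \<Union>(U ` I)" "x' \<in> \<Union>(U ` I)" "x \<in> U (m x')" "x' \<in> U (m x)" for x x'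
    using bspec[OF bspec[OF conjunct2[OF labelling] that(1)] that(2)] that(3,4) by simp
  have "\<forall>k :: nat. \<exists>w lab t. C1_smooth w \<and> (\<exists>L. L-lipschitz_on UNIV w) \<and> (\<forall>x. w x \<in> {0..1}) \<and> layer I U w lab t \<and>
    (\<forall>x\<in>\<Union>(U ` I). ball x ((1/2)^k) \<subseteq> U (m x) \<longrightarrow> (\<exists>r>0. \<forall>z\<in>ball x r. w z = 1))"
    by (intro allI single_layer[OF bump m(1) disc]) simp_all
  hence "\<exists>w lab t. \<forall>k. C1_smooth (w k) \<and> (\<exists>L. L-lipschitz_on UNIV (w k)) \<and> (\<forall>x. w k x \<in> {0..1}) \<and>
    layer I U (w k) (lab k) (t k) \<and>
    (\<forall>x\<in>\<Union>(U ` I). ball x ((1/2)^k) \<subseteq> U (m x) \<longrightarrow> (\<exists>r>0. \<forall>z\<in>ball x r. w k z = 1))"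
    unfolding choice_iff .
  then obtain w lab t where layers: "\<forall>k. C1_smooth (w k) \<and> (\<exists>L. L-lipschitz_on UNIV (w k)) \<and> (\<forall>x. w k x \<in> {0..1}) \<and>
    layer I U (w k) (lab k) (t k) \<and>
    (\<forall>x\<in>\<Union>(U ` I). ball x ((1/2)^k) \<subseteq> U (m x) \<longrightarrow> (\<exists>r>0. \<forall>z\<in>ball x r. w k z = 1))"
    by (elim exE)
  have wC1: "C1_smooth (w k)" and wlip: "\<exists>L. L-lipschitz_on UNIV (w k)"
    and w01: "w k x \<in> {0..1}" and wlay: "layer I U (w k) (lab k) (t k)" for k x
    using spec[OF layers, of k] by auto
  have w1: "\<exists>r>0. \<forall>z\<in>ball x r. w k z = 1" if "x \<in> \<Union>(U ` I)" "ball x ((1/2)^k) \<subseteq> U (m x)" for k x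
    using spec[OF layers, of k] that by metis
  define \<omega> where "\<omega> n x = (\<Prod>k<n. 1 - w k x)" for n x
  define \<psi> where "\<psi> k x = w k x * \<omega> k x" for k x
  have \<omega>C1: "C1_smooth (\<omega> n)" for n
  proof (induction n)
    case (Suc n)
    have "C1_smooth (\<lambda>x. \<omega> n x *\<^sub>R (1 - w n x))" by (intro C1_smooth_scaleR Suc C1_smooth_diff C1_smooth_const wC1)
    thus ?case by (simp add: \<omega>_def[abs_def])
  qed (simp add: \<omega>_def[abs_def] C1_smooth_const)
  have \<omega>01: "\<omega> n x \<in> {0..1}" for n x
    unfolding \<omega>_def using w01 by (auto intro!: prod_nonneg prod_le_1)
  have \<omega>lip: "\<exists>L. L-lipschitz_on UNIV (\<omega> n)" for n
  proof (induction n)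
    case 0
    show ?case by (auto simp: \<omega>_def[abs_def] intro: lipschitz_on_constant)
  next
    case (Suc n)
    then obtain L where L: "L-lipschitz_on UNIV (\<omega> n)" by blast
    obtain L' where "L'-lipschitz_on UNIV (w n)" using wlip by blast
    hence "(0 + L')-lipschitz_on UNIV (\<lambda>x. 1 - w n x)" by (intro lipschitz_on_diff lipschitz_on_constant)
    from lipschitz_on_mult_unit[OF L \<omega>01 this] w01 show ?case by (auto simp: \<omega>_def[abs_def])
  qed
  have \<psi>C1: "C1_smooth (\<psi> k)" for k
    using C1_smooth_scaleR[OF wC1 \<omega>C1, of k k] by (simp add: \<psi>_def[abs_def])
  have "\<exists>\<Lambda>. \<forall>k. (\<Lambda> k)-lipschitz_on UNIV (\<psi> k)"
  proof (intro choice allI)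
    fix k
    obtain L L' where "L-lipschitz_on UNIV (w k)" "L'-lipschitz_on UNIV (\<omega> k)" using wlip \<omega>lip by metis
    from lipschitz_on_mult_unit[OF this(1) w01 this(2) \<omega>01]
    show "\<exists>\<Lambda>. \<Lambda>-lipschitz_on UNIV (\<psi> k)" by (auto simp: \<psi>_def[abs_def])
  qed
  then obtain \<Lambda> where \<Lambda>: "\<forall>k. (\<Lambda> k)-lipschitz_on UNIV (\<psi> k)" by (rule exE)
  have nonneg: "\<psi> k x \<ge> 0" for k x using w01[of k x] \<omega>01[of k x] by (simp add: \<psi>_def)
  have sum: "(\<Sum>k<n. \<psi> k x) = 1 - \<omega> n x" for n x
    by (induction n) (auto simp: \<psi>_def \<omega>_def algebra_simps)
  hence le1: "(\<Sum>k<n. \<psi> k x) \<le> 1" for n x using \<omega>01[of n x] by simp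
  have lay: "layer I U (\<psi> k) (lab k) (t k)" for k
    using wlay[of k] unfolding layer_def \<psi>_def by (metis mult_zero_left)
  have one: "\<exists>N. \<exists>r>0. \<forall>n\<ge>N. \<forall>z\<in>ball x r. (\<Sum>k<n. \<psi> k z) = 1" if x: "x \<in> \<Union>(U ` I)" for x
  proof -
    obtain e where e: "e > 0" "ball x e \<subseteq> U (m x)" using opn[OF m(1)[OF x]] m(2)[OF x] openE by blast
    obtain k where "(1/2) ^ k < e" using real_arch_pow_inv[OF e(1), of "1/2"] by auto
    hence "ball x ((1/2)^k) \<subseteq> U (m x)" using e(2) by (meson less_imp_le subset_ball subset_trans)
    from w1[OF x this] obtain r where r: "r > 0" "\<forall>z\<in>ball x r. w k z = 1" by blast
    have "\<omega> n z = 0" if "n \<ge> Suc k" "z \<in> ball x r" for n z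
      unfolding \<omega>_def using that r(2) by (intro prod_zero bexI[of _ k]) auto
    thus ?thesis using r(1) by (intro exI[of _ "Suc k"] exI[of _ r]) (auto simp: sum)
  qed
  show ?thesis
  proof (rule that[of \<psi> \<Lambda> lab t])
    show "C1_smooth (\<psi> k)" for k by (rule \<psi>C1)
    show "(\<Lambda> k)-lipschitz_on UNIV (\<psi> k)" for k by (rule spec[OF \<Lambda>])
    show "\<psi> k x \<ge> 0" for k x by (rule nonneg)
    show "(\<Sum>k<n. \<psi> k x) \<le> 1" for n x by (rule le1)
    show "layer I U (\<psi> k) (lab k) (t k)" for k by (rule lay)
    show "\<exists>N. \<exists>r>0. \<forall>n\<ge>N. \<forall>z\<in>ball x r. (\<Sum>k<n. \<psi> k z) = 1" if "x \<in> \<Union>(U ` I)" for x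
      using that by (rule one)
  qed
qed

section \<open>Gluing local models\<close>

text \<open>
  A mapping \<open>E\<close> assembled from smooth pieces becomes smooth after multiplication by \<open>\<psi>\<close> if the places
  where the pieces fail to fit together lie in the interior of the zero set of \<open>\<psi>\<close>.
\<close>
lemma C1_smooth_scaleR_local:
  fixes \<psi> :: "'a::real_normed_vector \<Rightarrow> real"
  assumes \<psi>: "C1_smooth \<psi>"
    and loc: "\<And>x. (\<exists>r>0. \<forall>z\<in>ball x r. \<psi> z = 0) \<or> (\<exists>r>0. \<exists>h. C1_smooth h \<and> (\<forall>z\<in>ball x r. E z = h z))"
  shows "C1_smooth (\<lambda>x. \<psi> x *\<^sub>R E x)"
proof (rule C1_smooth_local)
  fix x
  from loc[of x] show "\<exists>U h. open U \<and> x \<in> U \<and> C1_smooth h \<and> (\<forall>z\<in>U. \<psi> z *\<^sub>R E z = h z)"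
  proof (elim disjE exE conjE)
    fix r :: real assume "r > 0" "\<forall>z\<in>ball x r. \<psi> z = 0"
    thus ?thesis by (intro exI[of _ "ball x r"] exI[of _ "\<lambda>_. 0"]) (auto intro: C1_smooth_const)
  next
    fix r :: real and h assume "r > 0" "C1_smooth h" "\<forall>z\<in>ball x r. E z = h z"
    thus ?thesis by (intro exI[of _ "ball x r"] exI[of _ "\<lambda>z. \<psi> z *\<^sub>R h z"]) (auto intro: C1_smooth_scaleR \<psi>)
  qed
qed

text \<open>
  The combination of \<open>\<Delta> 0, \<dots>, \<Delta> (n - 1)\<close> with weights \<open>\<psi> k x\<close> in which \<open>G\<close> receives the remaining
  weight.
\<close>
definition glue :: "nat \<Rightarrow> (nat \<Rightarrow> 'a \<Rightarrow> real) \<Rightarrow> (nat \<Rightarrow> 'a \<Rightarrow> 'b::real_vector) \<Rightarrow> ('a \<Rightarrow> 'b) \<Rightarrow> 'a \<Rightarrow> 'b"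
  where "glue n \<psi> \<Delta> G x = G x + (\<Sum>k<n. \<psi> k x *\<^sub>R (\<Delta> k x - G x))"

lemma C1_smooth_glue:
  fixes \<psi> :: "nat \<Rightarrow> 'a::real_normed_vector \<Rightarrow> real" and G :: "'a \<Rightarrow> 'b::real_normed_vector"
  assumes \<psi>: "\<And>k. C1_smooth (\<psi> k)" and G: "C1_smooth G"
    and loc: "\<And>k x. (\<exists>r>0. \<forall>z\<in>ball x r. \<psi> k z = 0) \<or> (\<exists>r>0. \<exists>h. C1_smooth h \<and> (\<forall>z\<in>ball x r. \<Delta> k z = h z))"
  shows "C1_smooth (\<lambda>x. \<psi> k x *\<^sub>R (\<Delta> k x - G x))" "C1_smooth (glue n \<psi> \<Delta> G)"
proof -
  show *: "C1_smooth (\<lambda>x. \<psi> k x *\<^sub>R (\<Delta> k x - G x))" for k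
  proof (rule C1_smooth_scaleR_local[OF \<psi>])
    fix x
    show "(\<exists>r>0. \<forall>z\<in>ball x r. \<psi> k z = 0) \<or> (\<exists>r>0. \<exists>h. C1_smooth h \<and> (\<forall>z\<in>ball x r. \<Delta> k z - G z = h z))"
      using loc[of x k] C1_smooth_diff[OF _ G] by metis
  qed
  show "C1_smooth (glue n \<psi> \<Delta> G)" unfolding glue_def [abs_def]
    by (intro C1_smooth_add G C1_smooth_sum *)
qed

text \<open>
  The derivative of the glued mapping is the weighted mean of the derivatives, up to the
  errors \<open>\<Lambda> k * e k\<close> which stem from differentiating the weights.  With \<open>T = 0\<close> this bounds the derivative, and
  with \<open>T = D a\<close> it compares the derivative with \<open>D\<close> at a point of \<open>A\<close>.
\<close>
lemma norm_bderiv_glue: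
  fixes \<psi> :: "nat \<Rightarrow> 'a::real_normed_vector \<Rightarrow> real" and G :: "'a \<Rightarrow> 'b::real_normed_vector"
  assumes \<psi>: "\<And>k. C1_smooth (\<psi> k)" and \<Lambda>: "\<And>k. (\<Lambda> k)-lipschitz_on UNIV (\<psi> k)" and G: "C1_smooth G"
    and nonneg: "\<And>k x. \<psi> k x \<ge> 0" and le1: "(\<Sum>k<n. \<psi> k x) \<le> 1"
    and loc: "\<And>k x. (\<exists>r>0. \<forall>z\<in>ball x r. \<psi> k z = 0) \<or> (\<exists>r>0. \<exists>h. C1_smooth h \<and> (\<forall>z\<in>ball x r. \<Delta> k z = h z))"
    and at_x: "\<And>k. k < n \<Longrightarrow> (\<exists>r>0. \<forall>z\<in>ball x r. \<psi> k z = 0) \<or> (\<exists>r>0. \<exists>h. C1_smooth h \<and> (\<forall>z\<in>ball x r. \<Delta> k z = h z)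
         \<and> norm (bderiv h x - T) \<le> \<eta> \<and> norm (h x - G x) \<le> e k)"
    and pos: "\<eta> \<ge> 0" "\<And>k. e k \<ge> 0"
  shows "norm (bderiv (glue n \<psi> \<Delta> G) x - T)
    \<le> (1 - (\<Sum>k<n. \<psi> k x)) * norm (bderiv G x - T) + (\<Sum>k<n. \<psi> k x) * \<eta> + (\<Sum>k<n. \<Lambda> k * e k)"
proof -
  define \<theta> where "\<theta> k = (\<lambda>x. \<psi> k x *\<^sub>R (\<Delta> k x - G x))" for k
  have C1\<theta>: "C1_smooth (\<theta> k)" for k
    unfolding \<theta>_def by (rule C1_smooth_glue(1)[OF \<psi> G loc])
  have eq: "bderiv (glue n \<psi> \<Delta> G) x = bderiv G x + (\<Sum>k<n. bderiv (\<theta> k) x)"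
    using C1\<theta> by (simp add: glue_def[abs_def] bderiv_add[OF G C1_smooth_sum] bderiv_sum flip: \<theta>_def)
  have summand: "norm (bderiv (\<theta> k) x - \<psi> k x *\<^sub>R (T - bderiv G x)) \<le> \<psi> k x * \<eta> + \<Lambda> k * e k" if "k < n" for k
    using at_x[OF that]
  proof (elim disjE exE conjE)
    fix r :: real assume r: "r > 0" "\<forall>z\<in>ball x r. \<psi> k z = 0"
    have "bderiv (\<theta> k) x = bderiv (\<lambda>_. 0) x"
      by (rule bderiv_cong_open[of _ "ball x r"]) (use r in \<open>auto simp: C1_smooth_const \<theta>_def\<close>)
    thus ?thesis using r pos nonneg lipschitz_on_nonneg[OF \<Lambda>[of k]] by (simp add: bderiv_const)
  next
    fix r :: real and h
    assume r: "r > 0" and h: "C1_smooth h" "\<forall>z\<in>ball x r. \<Delta> k z = h z"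
      "norm (bderiv h x - T) \<le> \<eta>" "norm (h x - G x) \<le> e k"
    have hG: "C1_smooth (\<lambda>x. h x - G x)" by (intro C1_smooth_diff h G)
    have "bderiv (\<theta> k) x = bderiv (\<lambda>x. \<psi> k x *\<^sub>R (h x - G x)) x"
      by (rule bderiv_cong_open[of _ "ball x r"]) (use r h(2) in \<open>auto simp: C1_smooth_scaleR \<psi> hG \<theta>_def\<close>)
    hence "norm (bderiv (\<theta> k) x - \<psi> k x *\<^sub>R bderiv (\<lambda>x. h x - G x) x) \<le> \<Lambda> k * norm (h x - G x)"
      using norm_bderiv_scaleR[OF \<psi> hG \<Lambda>] by simp
    also have "\<dots> \<le> \<Lambda> k * e k" using h(4) lipschitz_on_nonneg[OF \<Lambda>[of k]] by (intro mult_left_mono)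
    finally have 1: "norm (bderiv (\<theta> k) x - \<psi> k x *\<^sub>R (bderiv h x - bderiv G x)) \<le> \<Lambda> k * e k"
      by (simp add: bderiv_diff h(1) G)
    have 2: "norm (\<psi> k x *\<^sub>R (bderiv h x - T)) \<le> \<psi> k x * \<eta>"
      using h(3) nonneg by (simp add: mult_left_mono)
    have split: "bderiv (\<theta> k) x - \<psi> k x *\<^sub>R (T - bderiv G x)
        = (bderiv (\<theta> k) x - \<psi> k x *\<^sub>R (bderiv h x - bderiv G x)) + \<psi> k x *\<^sub>R (bderiv h x - T)"
      by (simp add: algebra_simps)
    have "norm (bderiv (\<theta> k) x - \<psi> k x *\<^sub>R (T - bderiv G x)) \<le> \<Lambda> k * e k + \<psi> k x * \<eta>"
      unfolding split by (rule norm_triangle_mono[OF 1 2])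
    thus ?thesis by linarith
  qed
  have "bderiv (glue n \<psi> \<Delta> G) x - T = (1 - (\<Sum>k<n. \<psi> k x)) *\<^sub>R (bderiv G x - T)
      + (\<Sum>k<n. bderiv (\<theta> k) x - \<psi> k x *\<^sub>R (T - bderiv G x))"
    by (simp add: eq sum_subtractf sum.distrib algebra_simps scaleR_sum_left)
  also have "norm \<dots> \<le> (1 - (\<Sum>k<n. \<psi> k x)) * norm (bderiv G x - T) + (\<Sum>k<n. \<psi> k x * \<eta> + \<Lambda> k * e k)"
    using le1 summand by (intro norm_triangle_mono order.trans[OF norm_sum] sum_mono) auto
  finally show ?thesis by (simp add: sum.distrib sum_distrib_right)
qed

section \<open>Patching approximations together towards a closed set\<close>

lemma C1_smooth_stationary_limit:
  fixes g :: "nat \<Rightarrow> 'a::real_normed_vector \<Rightarrow> 'b::real_normed_vector"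
  assumes C1: "\<And>n. C1_smooth (g n)" and bound: "\<And>n x. norm (bderiv (g n) x) \<le> K"
    and stat: "\<And>x. \<exists>N. \<exists>r>0. \<forall>n\<ge>N. \<forall>z\<in>ball x r. g n z = g N z"
  shows "\<exists>h. C1_smooth h \<and> (\<forall>x. norm (bderiv h x) \<le> K) \<and>
    (\<forall>x N. (\<forall>n\<ge>N. g n x = g N x) \<longrightarrow> h x = g N x)"
proof -
  \<comment> \<open>\<open>G x\<close> is the eventual value of the sequence at \<open>x\<close>.\<close>
  define G where "G x = g (LEAST N. \<forall>n\<ge>N. g n x = g N x) x" for x
  have G: "G x = g N x" if "\<forall>n\<ge>N. g n x = g N x" for x N
  proof -
    let ?M = "LEAST N. \<forall>n\<ge>N. g n x = g N x"
    have "\<forall>n\<ge>?M. g n x = g ?M x" using that by (rule LeastI[of "\<lambda>N. \<forall>n\<ge>N. g n x = g N x"])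
    moreover have "?M \<le> N" using that by (rule Least_le[of "\<lambda>N. \<forall>n\<ge>N. g n x = g N x"])
    ultimately have "g N x = g ?M x" by blast
    thus ?thesis by (simp only: G_def)
  qed
  have loc: "\<exists>N. \<exists>r>0. \<forall>z\<in>ball x r. G z = g N z" for x
  proof -
    obtain N r where "r > 0" "\<forall>n\<ge>N. \<forall>z\<in>ball x r. g n z = g N z" using stat by blast
    thus ?thesis using G by blast
  qed
  have "C1_smooth G"
  proof (rule C1_smooth_local)
    fix x
    obtain N r where "r > 0" "\<forall>z\<in>ball x r. G z = g N z" using loc by blast
    thus "\<exists>U h. open U \<and> x \<in> U \<and> C1_smooth h \<and> (\<forall>z\<in>U. G z = h z)"
      by (intro exI[of _ "ball x r"] exI[of _ "g N"]) (auto simp: C1)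
  qed
  moreover have "norm (bderiv G x) \<le> K" for x
  proof -
    obtain N r where "r > 0" "\<forall>z\<in>ball x r. G z = g N z" using loc by blast
    hence "bderiv G x = bderiv (g N) x" by (intro bderiv_cong_open[of _ "ball x r"]) (auto simp: C1)
    thus ?thesis using bound by simp
  qed
  ultimately show ?thesis using G by (intro exI[of _ G]) blast
qed

text \<open>
  The mapping \<open>F n\<close> is good only within distance \<open>\<rho> n\<close> of \<open>A\<close>.  The recursion
  \<open>g (n + 1) = g n + c n * (F (n + 1) - F n)\<close> with a cut-off \<open>c n\<close> that lives within
  distance \<open>\<rho> (n + 1)\<close> of \<open>A\<close> modifies \<open>g n\<close> only where it still equals \<open>F n\<close>, because \<open>\<rho>\<close> is at least halved
  in each step.  So the bounds are not accumulated: where \<open>g n\<close> is modified, the derivative of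
  \<open>g (n + 1)\<close> is a mean of those of \<open>F n\<close> and \<open>F (n + 1)\<close>, plus a term in which the slope
  \<open>2 * K / \<rho> (n + 1)\<close> of \<open>c n\<close> meets a difference of size \<open>M * \<rho> (n + 1)\<close>.
\<close>
lemma diagonal_gluing:
  fixes F :: "nat \<Rightarrow> 'a::real_normed_vector \<Rightarrow> 'b::real_normed_vector"
  assumes bump: "\<And>(S :: 'a set) d. d > 0 \<Longrightarrow> \<exists>w. smooth_bump K S d w" and K: "K \<ge> 0"
    and A: "closed A" "A \<noteq> {}" and F: "\<And>n. C1_smooth (F n)"
    and \<rho>: "\<And>n. \<rho> n > 0" "\<And>n. 2 * \<rho> (Suc n) \<le> \<rho> n"
    and F0: "\<And>x. norm (bderiv (F 0) x) \<le> \<kappa>"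
    and F': "\<And>n x a. a \<in> A \<Longrightarrow> dist x a < \<rho> n \<Longrightarrow> norm (bderiv (F n) x) \<le> \<kappa>"
    and diff: "\<And>n x a. a \<in> A \<Longrightarrow> dist x a < \<rho> (Suc n) \<Longrightarrow> norm (F (Suc n) x - F n x) \<le> M * \<rho> (Suc n)"
    and stat: "\<And>a. a \<in> A \<Longrightarrow> \<exists>N. \<exists>r>0. \<forall>n\<ge>N. \<forall>z\<in>ball a r. F n z = F N z"
  obtains g where "C1_smooth g" "\<And>x. norm (bderiv g x) \<le> \<kappa> + 2 * K * M"
    "\<And>a. a \<in> A \<Longrightarrow> \<exists>N. \<exists>r>0. \<forall>n\<ge>N. \<forall>z\<in>ball a r. g z = F n z"
proof -
  obtain c where c: "\<And>n. smooth_bump K A (\<rho> (Suc n) / 2) (c n)"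
    using bump[of "\<rho> (Suc _) / 2" A] \<rho>(1) by (metis half_gt_zero)
  have cC1: "C1_smooth (c n)" and clip: "(2 * K / \<rho> (Suc n))-lipschitz_on UNIV (c n)"
    and c01: "0 \<le> c n x" "c n x \<le> 1"
    and c0: "(\<And>a. a \<in> A \<Longrightarrow> \<rho> (Suc n) \<le> dist x a) \<Longrightarrow> c n x = 0" for n x a
    using c[of n] by (auto simp: smooth_bump_def mult.commute)
  have c1: "c n x = 1" if "a \<in> A" "dist x a < \<rho> (Suc n) / 2" for n x a
    using c[of n] that less_imp_le unfolding smooth_bump_def by blast
  have M: "M \<ge> 0"
  proof -
    obtain a where "a \<in> A" using A by blast
    from diff[OF this, of a 0] \<rho>(1)[of 1] have "0 \<le> M * \<rho> 1" by simp (metis norm_ge_zero order_trans)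
    thus ?thesis using \<rho>(1)[of 1] by (simp add: zero_le_mult_iff)
  qed
  define g where "g = rec_nat (F 0) (\<lambda>n gn x. gn x + c n x *\<^sub>R (F (Suc n) x - F n x))"
  have g0: "g 0 = F 0" by (simp add: g_def)
  have gS: "g (Suc n) = (\<lambda>x. g n x + c n x *\<^sub>R (F (Suc n) x - F n x))" for n by (simp add: g_def)
  have gC1: "C1_smooth (g n)" for n
    by (induction n) (auto simp: g0 gS F cC1 intro!: C1_smooth_add C1_smooth_scaleR C1_smooth_diff)
  have gF: "g n x = F n x" if "a \<in> A" "dist x a < \<rho> n / 2" for n x a
    using that(2)
  proof (induction n)
    case (Suc n)
    have "dist x a < \<rho> n / 2" using Suc.prems \<rho>(2)[of n] \<rho>(1)[of "Suc n"] by linarith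
    with Suc show ?case by (simp add: gS c1[OF that(1) Suc.prems])
  qed (simp add: g0)
  have g': "norm (bderiv (g n) x) \<le> \<kappa> + 2 * K * M" for n x
  proof (induction n)
    case 0
    thus ?case using F0[of x] K M by (simp add: g0 add_increasing2)
  next
    case (Suc n)
    have diffC1: "C1_smooth (\<lambda>x. F (Suc n) x - F n x)" by (intro C1_smooth_diff F)
    have bd: "bderiv (g (Suc n)) x = bderiv (g n) x + bderiv (\<lambda>x. c n x *\<^sub>R (F (Suc n) x - F n x)) x"
      unfolding gS by (intro bderiv_add gC1 C1_smooth_scaleR cC1 diffC1)
    show ?case
    proof (cases "\<exists>a\<in>A. dist x a < \<rho> (Suc n)")
      case False
      hence "c n x = 0" by (intro c0) force
      moreover have "bderiv (c n) x = 0" by (rule bderiv_zero_at_min[OF cC1 c01(1)]) fact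
      ultimately have "bderiv (\<lambda>x. c n x *\<^sub>R (F (Suc n) x - F n x)) x = 0"
        by (simp add: bderiv_scaleR cC1 diffC1)
      thus ?thesis using Suc bd by simp
    next
      case True
      then obtain a where a: "a \<in> A" "dist x a < \<rho> (Suc n)" by blast
      have a': "dist x a < \<rho> n / 2" using a \<rho>(2)[of n] by linarith
      have "bderiv (g n) x = bderiv (F n) x"
        by (rule bderiv_cong_open[of _ "ball a (\<rho> n / 2)"]) (use a a' gF in \<open>auto simp: F dist_commute\<close>)
      hence "bderiv (g (Suc n)) x = ((1 - c n x) *\<^sub>R bderiv (F n) x + c n x *\<^sub>R bderiv (F (Suc n)) x)
          + (bderiv (\<lambda>x. c n x *\<^sub>R (F (Suc n) x - F n x)) x - c n x *\<^sub>R bderiv (\<lambda>x. F (Suc n) x - F n x) x)"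
        by (simp add: bd bderiv_diff F algebra_simps)
      moreover have "norm ((1 - c n x) *\<^sub>R bderiv (F n) x + c n x *\<^sub>R bderiv (F (Suc n)) x) \<le> (1 - c n x) * \<kappa> + c n x * \<kappa>"
        using c01[of n x] F'[OF a(1), of x n] F'[OF a] a' \<rho>(1)[of n]
        by (intro norm_triangle_mono) (auto simp: mult_left_mono)
      moreover have "norm (bderiv (\<lambda>x. c n x *\<^sub>R (F (Suc n) x - F n x)) x - c n x *\<^sub>R bderiv (\<lambda>x. F (Suc n) x - F n x) x)
          \<le> 2 * K / \<rho> (Suc n) * (M * \<rho> (Suc n))"
        by (rule order.trans[OF norm_bderiv_scaleR[OF cC1 diffC1 clip]])
          (use diff[OF a] K \<rho>(1)[of "Suc n"] in \<open>intro mult_left_mono; simp\<close>)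
      ultimately have "norm (bderiv (g (Suc n)) x) \<le> ((1 - c n x) * \<kappa> + c n x * \<kappa>) + 2 * K / \<rho> (Suc n) * (M * \<rho> (Suc n))"
        by (simp only: norm_triangle_mono)
      thus ?thesis using \<rho>(1)[of "Suc n"] by (simp add: algebra_simps)
    qed
  qed
  have \<rho>_anti: "\<rho> n \<le> \<rho> m" if "m \<le> n" for m n
    using that
  proof (induction rule: dec_induct)
    case (step k)
    thus ?case using \<rho>(1)[of "Suc k"] \<rho>(2)[of k] by linarith
  qed simp
  have near: "\<exists>N. \<exists>r>0. \<forall>n\<ge>N. \<forall>z\<in>ball a r. g n z = F N z \<and> F n z = F N z" if a: "a \<in> A" for a
  proof -
    obtain N r where r: "r > 0" "\<And>n z. n \<ge> N \<Longrightarrow> z \<in> ball a r \<Longrightarrow> F n z = F N z" using stat[OF a] by metis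
    have eq: "g n z = F N z" if "n \<ge> N" "z \<in> ball a (min r (\<rho> N / 2))" for n z
      using that(1)
    proof (induction rule: dec_induct)
      case base
      thus ?case using gF[OF a, of z N] that by (simp add: dist_commute)
    next
      case (step k)
      have "F (Suc k) z = F N z" "F k z = F N z" using r(2)[of k z] r(2)[of "Suc k" z] that step by auto
      with step show ?case by (simp add: gS)
    qed
    have "g n z = F N z \<and> F n z = F N z" if "n \<ge> N" "z \<in> ball a (min r (\<rho> N / 2))" for n z
      using eq[OF that] r(2)[OF that(1), of z] that(2) by auto
    moreover have "min r (\<rho> N / 2) > 0" using r(1) \<rho>(1)[of N] by simp
    ultimately show ?thesis by blast
  qed
  have stat_g: "\<exists>N. \<exists>r>0. \<forall>n\<ge>N. \<forall>z\<in>ball x r. g n z = g N z" for x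
  proof (cases "x \<in> A")
    case True
    from near[OF this] obtain N r where r: "r > 0" "\<forall>n\<ge>N. \<forall>z\<in>ball x r. g n z = F N z" by blast
    thus ?thesis by (intro exI[of _ N] exI[of _ r]) auto
  next
    case False
    define r where "r = infdist x A"
    have r: "r > 0" using False A by (simp add: r_def infdist_pos_not_in_closed)
    have \<rho>_pow: "\<rho> n \<le> \<rho> 0 * (1/2) ^ n" for n
    proof (induction n)
      case (Suc n)
      thus ?case using \<rho>(2)[of n] by simp
    qed simp
    have "(\<lambda>n. \<rho> 0 * (1/2) ^ n) \<longlonglongrightarrow> \<rho> 0 * 0" by (intro tendsto_mult_left LIMSEQ_power_zero) simp
    hence "\<forall>\<^sub>F n in sequentially. \<rho> 0 * (1/2) ^ n < r / 2" using r by (intro order_tendstoD) auto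
    then obtain N where "\<rho> 0 * (1/2) ^ N < r / 2" by (auto simp: eventually_sequentially)
    hence N: "\<rho> N < r / 2" using \<rho>_pow[of N] by linarith
    have "g n z = g N z" if "n \<ge> N" "z \<in> ball x (r / 2)" for n z
      using that(1)
    proof (induction rule: dec_induct)
      case (step k)
      have "c k z = 0"
      proof (rule c0)
        fix a assume "a \<in> A"
        hence "r \<le> dist x a" by (simp add: r_def infdist_le)
        moreover have "dist x a \<le> dist x z + dist z a" by (rule dist_triangle)
        moreover have "\<rho> (Suc k) \<le> \<rho> N" using step by (intro \<rho>_anti) auto
        ultimately show "\<rho> (Suc k) \<le> dist z a" using N that(2) by (simp add: dist_commute)
      qed
      with step show ?case by (simp add: gS)
    qed simp
    moreover have "r / 2 > 0" using r by simp
    ultimately show ?thesis by blast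
  qed
  obtain h where h: "C1_smooth h \<and> (\<forall>x. norm (bderiv h x) \<le> \<kappa> + 2 * K * M) \<and>
      (\<forall>x N. (\<forall>n\<ge>N. g n x = g N x) \<longrightarrow> h x = g N x)"
    using C1_smooth_stationary_limit[OF gC1 g' stat_g] by (rule exE)
  hence lim: "C1_smooth h" "\<And>x. norm (bderiv h x) \<le> \<kappa> + 2 * K * M"
    "\<And>x N. \<forall>n\<ge>N. g n x = g N x \<Longrightarrow> h x = g N x"
    by blast+
  have "\<exists>N. \<exists>r>0. \<forall>n\<ge>N. \<forall>z\<in>ball a r. h z = F n z" if "a \<in> A" for a
  proof -
    from near[OF that] obtain N r where r: "r > 0" and "\<forall>n\<ge>N. \<forall>z\<in>ball a r. g n z = F N z \<and> F n z = F N z"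
      by (elim exE conjE)
    hence gF: "\<And>n z. n \<ge> N \<Longrightarrow> z \<in> ball a r \<Longrightarrow> g n z = F N z"
      and FF: "\<And>n z. n \<ge> N \<Longrightarrow> z \<in> ball a r \<Longrightarrow> F n z = F N z" by blast+
    have "h z = F n z" if "n \<ge> N" "z \<in> ball a r" for n z
      using lim(3)[of N z] gF[OF _ that(2)] FF[OF that] by simp
    thus ?thesis using r by blast
  qed
  with lim(1,2) show ?thesis by (rule that)
qed

section \<open>One approximation step\<close>

text \<open>
  On \<open>A \<inter> V\<close> there are smooth approximations of \<open>f\<close> with arbitrarily small error \<open>\<tau>\<close>, whereas the
  errors in the derivative and in the Lipschitz constant stay below a fixed \<open>\<epsilon>\<close>.
\<close>
definition local_models ::
  "real \<Rightarrow> real \<Rightarrow> 'a::real_normed_vector set \<Rightarrow> ('a \<Rightarrow> 'b::real_normed_vector) \<Rightarrow> ('a \<Rightarrow> 'a \<Rightarrow>\<^sub>L 'b) \<Rightarrow> 'a set \<Rightarrow> bool"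
  where "local_models \<kappa> \<epsilon> A f D V \<longleftrightarrow> (\<forall>\<tau>>0. \<exists>\<Phi>. C1_smooth \<Phi> \<and> \<kappa>-lipschitz_on UNIV \<Phi> \<and>
    (\<forall>x\<in>A \<inter> V. norm (f x - \<Phi> x) \<le> \<tau> \<and> norm (bderiv \<Phi> x - D x) \<le> \<epsilon>) \<and>
    \<epsilon>-lipschitz_on (A \<inter> V) (\<lambda>x. f x - \<Phi> x))"

lemma sum_half_powers_le: "(\<Sum>k<n. \<epsilon> / 2 ^ Suc k) \<le> (\<epsilon> :: real)" if "\<epsilon> \<ge> 0"
proof -
  have "(\<Sum>k<n. \<epsilon> / 2 ^ Suc k) = \<epsilon> * (1 - (1/2) ^ n)"
    by (induction n) (auto simp: field_simps)
  also have "\<dots> \<le> \<epsilon> * 1" using that by (intro mult_left_mono) auto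
  finally show ?thesis by simp
qed

text \<open>
  The order of the choices is essential.  The weights \<open>\<psi> k\<close> with their slopes \<open>\<Lambda> k\<close> come first; then the
  widths \<open>\<rho> n\<close>, so small that the slopes of the first \<open>n\<close> weights are harmless within distance \<open>\<rho> n\<close> of
  \<open>A\<close>; then the accuracies \<open>\<tau> k\<close>, adapted to \<open>\<Lambda> k\<close>, to \<open>\<rho> (k + 1)\<close> and to the separation \<open>t k\<close> of the
  layer; and finally the local models and the global approximations of these accuracies.

  The estimate of \<open>f - g\<close> on \<open>A\<close> is done for each layer separately.  Two points closer than \<open>t k\<close> see
  the same local model, whose error has Lipschitz constant \<open>\<epsilon>\<close>; for points further apart the
  accuracy \<open>\<tau> k\<close> is so much smaller than \<open>t k\<close> that the difference is negligible.
\<close>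
lemma glue_local_models:
  fixes f :: "'a::real_normed_vector \<Rightarrow> 'b::real_normed_vector" and D :: "'a \<Rightarrow> 'a \<Rightarrow>\<^sub>L 'b"
  assumes bump: "\<And>(S :: 'a set) d. d > 0 \<Longrightarrow> \<exists>w. smooth_bump K S d w" and K: "K \<ge> 0"
    and A: "closed A" "A \<noteq> {}" and \<epsilon>: "\<epsilon> > 0" "2 * \<epsilon> \<le> \<kappa>"
    and U: "\<And>y. y \<in> A \<Longrightarrow> open (U y)" "\<And>y. y \<in> A \<Longrightarrow> y \<in> U y"
    and glob: "\<And>\<tau>. \<tau> > 0 \<Longrightarrow> \<exists>G. C1_smooth G \<and> \<kappa>-lipschitz_on UNIV G \<and> (\<forall>x\<in>A. norm (f x - G x) \<le> \<tau>)"
    and loc: "\<And>y. y \<in> A \<Longrightarrow> local_models \<kappa> \<epsilon> A f D (U y)"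
  shows "\<exists>g. C1_smooth g \<and> (\<forall>x. norm (bderiv g x) \<le> (3 + 16 * K) * \<kappa>) \<and>
    (\<forall>x\<in>A. norm (bderiv g x - D x) \<le> 3 * \<epsilon>) \<and> (3 * \<epsilon>)-lipschitz_on A (\<lambda>x. f x - g x)"
proof -
  have \<kappa>: "\<kappa> > 0" using \<epsilon> by simp
  obtain \<psi> :: "nat \<Rightarrow> 'a \<Rightarrow> real" and lab :: "nat \<Rightarrow> 'a \<Rightarrow> 'a" and t \<Lambda> where
    \<psi>: "\<And>k. C1_smooth (\<psi> k)" and \<Lambda>: "\<And>k. (\<Lambda> k)-lipschitz_on UNIV (\<psi> k)"
    and nonneg: "\<And>k x. \<psi> k x \<ge> 0" and le1: "\<And>n x. (\<Sum>k<n. \<psi> k x) \<le> 1"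
    and lay: "\<And>k. layer A U (\<psi> k) (lab k) (t k)"
    and one: "\<And>x. x \<in> \<Union>(U ` A) \<Longrightarrow> \<exists>N. \<exists>r>0. \<forall>n\<ge>N. \<forall>z\<in>ball x r. (\<Sum>k<n. \<psi> k z) = 1"
    by (rule layered_partition_of_unity[OF bump U(1)]) blast+
  have \<Lambda>0: "\<Lambda> k \<ge> 0" for k using \<Lambda>[of k] by (rule lipschitz_on_nonneg)
  have t: "t k > 0" for k using lay[of k] by (simp add: layer_def)
  have dich: "(\<exists>r>0. \<forall>z\<in>ball x r. \<psi> k z = 0) \<or> (\<exists>y\<in>A. ball x (t k) \<subseteq> U y \<and> (\<forall>z\<in>ball x (t k). lab k z = y))" for k x
    using lay[of k] by (simp add: layer_def)
  have \<psi>1: "\<psi> k x \<le> 1" for k x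
    using le1[where n = "Suc k" and x = x] sum_nonneg[of "{..<k}" "\<lambda>k. \<psi> k x"] nonneg by simp

  \<comment> \<open>Halving keeps the switching zones from overlapping, the bound \<open>t n\<close> keeps a point and a nearby point of
    \<open>A\<close> in the same piece of each earlier layer, and the third bound tames the slopes.\<close>
  define \<rho> where "\<rho> = rec_nat 1 (\<lambda>n \<rho>n. min (min (\<rho>n / 2) (t n)) (\<epsilon> / (3 * \<kappa> * (1 + (\<Sum>k<Suc n. \<Lambda> k)))))"
  have \<rho>S: "\<rho> (Suc n) = min (min (\<rho> n / 2) (t n)) (\<epsilon> / (3 * \<kappa> * (1 + (\<Sum>k<Suc n. \<Lambda> k))))" for n
    by (simp add: \<rho>_def)
  have \<Lambda>1: "1 + (\<Sum>k<n. \<Lambda> k) > 0" for n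
    using sum_nonneg[of "{..<n}" \<Lambda>] \<Lambda>0 by (simp add: add_pos_nonneg)
  have \<rho>pos: "\<rho> n > 0" for n
  proof (induction n)
    case (Suc n)
    have "\<epsilon> / (3 * \<kappa> * (1 + (\<Sum>k<Suc n. \<Lambda> k))) > 0" using \<epsilon> \<kappa> \<Lambda>1[of "Suc n"] by (intro divide_pos_pos mult_pos_pos) auto
    with Suc t show ?case by (simp only: \<rho>S) simp
  qed (simp add: \<rho>_def)
  have \<rho>half: "2 * \<rho> (Suc n) \<le> \<rho> n" for n using \<rho>S[of n] by linarith
  have \<rho>dec: "\<rho> (Suc n) \<le> \<rho> n" for n using \<rho>half[of n] \<rho>pos[of "Suc n"] by linarith
  have \<rho>t: "\<rho> n \<le> t k" if "k < n" for n k
  proof -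
    have "\<rho> n \<le> \<rho> (Suc k)" using lift_Suc_antimono_le[of \<rho>, OF \<rho>dec] that by (simp add: Suc_leI)
    thus ?thesis using \<rho>S[of k] by linarith
  qed
  have \<rho>\<Lambda>: "(\<Sum>k<n. \<Lambda> k) * (3 * \<kappa> * \<rho> n) \<le> \<epsilon>" for n
  proof (cases n)
    case (Suc m)
    have "\<rho> n \<le> \<epsilon> / (3 * \<kappa> * (1 + (\<Sum>k<n. \<Lambda> k)))" unfolding Suc \<rho>S by (rule min.cobounded2)
    hence "\<rho> n * (3 * \<kappa> * (1 + (\<Sum>k<n. \<Lambda> k))) \<le> \<epsilon>" using \<kappa> \<Lambda>1[of n] by (simp add: pos_le_divide_eq)
    thus ?thesis using \<kappa> \<rho>pos[of n] by (simp add: algebra_simps) (smt (verit) mult_pos_pos)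
  qed (use \<epsilon> in auto)

  define \<tau> where "\<tau> k = min (min (\<kappa> * \<rho> (Suc k)) (\<epsilon> / 2 ^ Suc k / (1 + \<Lambda> k))) (\<epsilon> / 2 ^ Suc k * t k / 2)" for k
  have \<tau>: "\<tau> k > 0" for k
    unfolding \<tau>_def using \<kappa> \<rho>pos \<epsilon> t \<Lambda>0 by (simp add: add_pos_nonneg)
  have \<tau>\<rho>: "\<tau> k \<le> \<kappa> * \<rho> (Suc k)" for k by (simp add: \<tau>_def)
  have \<tau>\<Lambda>: "\<Lambda> k * \<tau> k \<le> \<epsilon> / 2 ^ Suc k" for k
  proof -
    have "\<tau> k \<le> \<epsilon> / 2 ^ Suc k / (1 + \<Lambda> k)" by (simp add: \<tau>_def)
    hence "\<tau> k * (1 + \<Lambda> k) \<le> \<epsilon> / 2 ^ Suc k" using \<Lambda>0[of k] by (subst (asm) pos_le_divide_eq) auto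
    thus ?thesis using \<tau>[of k] by (simp add: algebra_simps)
  qed
  have \<tau>t: "2 * \<tau> k \<le> \<epsilon> / 2 ^ Suc k * t k" for k
  proof -
    have "\<tau> k \<le> (\<epsilon> / 2 ^ Suc k * t k) / 2" unfolding \<tau>_def by (rule min.cobounded2)
    thus ?thesis by (simp only: pos_le_divide_eq zero_less_numeral mult.commute[of "\<tau> k"])
  qed

  have "\<forall>n. \<exists>G. C1_smooth G \<and> \<kappa>-lipschitz_on UNIV G \<and> (\<forall>x\<in>A. norm (f x - G x) \<le> \<tau> n)"
    using glob \<tau> by blast
  then obtain G where G: "\<And>n. C1_smooth (G n)" and Glip: "\<And>n. \<kappa>-lipschitz_on UNIV (G n)"
    and Gf: "\<And>n x. x \<in> A \<Longrightarrow> norm (f x - G n x) \<le> \<tau> n" by metis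
  have "\<forall>k. \<forall>y\<in>A. \<exists>\<Phi>. C1_smooth \<Phi> \<and> \<kappa>-lipschitz_on UNIV \<Phi> \<and>
    (\<forall>x\<in>A \<inter> U y. norm (f x - \<Phi> x) \<le> \<tau> k \<and> norm (bderiv \<Phi> x - D x) \<le> \<epsilon>) \<and>
    \<epsilon>-lipschitz_on (A \<inter> U y) (\<lambda>x. f x - \<Phi> x)"
    using loc \<tau> unfolding local_models_def by blast
  then obtain \<Phi> where models: "\<forall>k. \<forall>y\<in>A. C1_smooth (\<Phi> k y) \<and> \<kappa>-lipschitz_on UNIV (\<Phi> k y) \<and>
    (\<forall>x\<in>A \<inter> U y. norm (f x - \<Phi> k y x) \<le> \<tau> k \<and> norm (bderiv (\<Phi> k y) x - D x) \<le> \<epsilon>) \<and>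
    \<epsilon>-lipschitz_on (A \<inter> U y) (\<lambda>x. f x - \<Phi> k y x)"
    unfolding bchoice_iff choice_iff by (rule exE)
  have \<Phi>C1: "C1_smooth (\<Phi> k y)" and \<Phi>lip: "\<kappa>-lipschitz_on UNIV (\<Phi> k y)"
    and \<Phi>e: "\<epsilon>-lipschitz_on (A \<inter> U y) (\<lambda>x. f x - \<Phi> k y x)" if "y \<in> A" for k y
    using bspec[OF spec[OF models] that, of k] by simp_all
  have \<Phi>f: "norm (f x - \<Phi> k y x) \<le> \<tau> k" and \<Phi>D: "norm (bderiv (\<Phi> k y) x - D x) \<le> \<epsilon>"
    if "y \<in> A" "x \<in> A" "x \<in> U y" for k y x
    using bspec[OF spec[OF models] that(1), of k] that(2,3) by simp_all
  \<comment> \<open>In layer \<open>k\<close> the local model at a point is the one selected by the label of the point.\<close>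
  define \<Delta> where "\<Delta> k z = \<Phi> k (lab k z) z" for k z
  define F where "F n = glue n \<psi> \<Delta> (G n)" for n
  have \<Delta>loc: "(\<exists>r>0. \<forall>z\<in>ball x r. \<psi> k z = 0) \<or> (\<exists>r>0. \<exists>h. C1_smooth h \<and> (\<forall>z\<in>ball x r. \<Delta> k z = h z))" for k x
    using dich[of x k]
  proof (elim disjE bexE conjE)
    fix y assume "y \<in> A" "\<forall>z\<in>ball x (t k). lab k z = y"
    thus ?thesis using t[of k] \<Phi>C1[of y k] by (intro disjI2 exI[of _ "t k"] conjI exI[of _ "\<Phi> k y"]) (auto simp: \<Delta>_def)
  qed simp
  have FC1: "C1_smooth (F n)" for n unfolding F_def by (rule C1_smooth_glue(2)[OF \<psi> G \<Delta>loc])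

  \<comment> \<open>Both mappings are close to \<open>f a\<close> at \<open>a\<close> and have Lipschitz constant \<open>\<kappa>\<close>.\<close>
  have model_close: "norm (\<Phi> k y x - G n x) \<le> \<tau> k + \<tau> n + 2 * \<kappa> * dist x a"
    if "y \<in> A" "a \<in> A" "a \<in> U y" for k n y a x
  proof -
    have "\<Phi> k y x - G n x = (\<Phi> k y x - \<Phi> k y a) - (f a - \<Phi> k y a) + (f a - G n a) - (G n x - G n a)" by simp
    also have "norm \<dots> \<le> norm (\<Phi> k y x - \<Phi> k y a) + norm (f a - \<Phi> k y a) + norm (f a - G n a) + norm (G n x - G n a)"
      by (intro order.trans[OF norm_triangle_ineq4] add_mono order.trans[OF norm_triangle_ineq] order_refl)
    also have "\<dots> \<le> \<kappa> * dist x a + \<tau> k + \<tau> n + \<kappa> * dist x a"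
      using lipschitz_onD[OF \<Phi>lip[OF that(1)], of x a k] lipschitz_onD[OF Glip, of x a n] \<Phi>f[OF that] Gf[OF that(2)]
      by (intro add_mono) (auto simp: dist_norm)
    finally show ?thesis by simp
  qed
  have deriv: "norm (bderiv (F n) x - T) \<le> (1 - (\<Sum>k<n. \<psi> k x)) * norm (bderiv (G n) x - T) + \<eta> + 2 * \<epsilon>"
    if a: "a \<in> A" "dist x a < \<rho> n" and \<eta>: "\<eta> \<ge> 0"
      and T: "\<And>k y. y \<in> A \<Longrightarrow> ball x (t k) \<subseteq> U y \<Longrightarrow> norm (bderiv (\<Phi> k y) x - T) \<le> \<eta>" for n x a T \<eta>
  proof -
    define e where "e k = \<tau> k + 3 * \<kappa> * \<rho> n" for k
    have "norm (bderiv (F n) x - T) \<le> (1 - (\<Sum>k<n. \<psi> k x)) * norm (bderiv (G n) x - T)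
        + (\<Sum>k<n. \<psi> k x) * \<eta> + (\<Sum>k<n. \<Lambda> k * e k)"
      unfolding F_def
    proof (rule norm_bderiv_glue[OF \<psi> \<Lambda> G nonneg le1 \<Delta>loc _ \<eta>])
      show "0 \<le> e k" for k using \<tau>[of k] \<kappa> \<rho>pos[of n] by (simp add: e_def)
      fix k assume k: "k < n"
      show "(\<exists>r>0. \<forall>z\<in>ball x r. \<psi> k z = 0) \<or> (\<exists>r>0. \<exists>h. C1_smooth h \<and> (\<forall>z\<in>ball x r. \<Delta> k z = h z)
         \<and> norm (bderiv h x - T) \<le> \<eta> \<and> norm (h x - G n x) \<le> e k)"
        using dich[of x k]
      proof (elim disjE bexE conjE)
        fix y assume y: "y \<in> A" "ball x (t k) \<subseteq> U y" "\<forall>z\<in>ball x (t k). lab k z = y"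
        have "a \<in> U y" using a(2) \<rho>t[OF k] y(2) by auto
        from model_close[OF y(1) a(1) this, of k x n]
        have "norm (\<Phi> k y x - G n x) \<le> \<tau> k + \<tau> n + 2 * \<kappa> * dist x a" .
        moreover have "\<kappa> * dist x a \<le> \<kappa> * \<rho> n" using a(2) \<kappa> by simp
        moreover have "\<tau> n \<le> \<kappa> * \<rho> n"
          using \<tau>\<rho>[of n] mult_left_mono[OF \<rho>dec[of n], of \<kappa>] \<kappa> by linarith
        ultimately have "norm (\<Phi> k y x - G n x) \<le> e k" by (simp add: e_def)
        thus ?thesis using y T[OF y(1,2)] t[of k] \<Phi>C1[of y k]
          by (intro disjI2 exI[of _ "t k"] conjI exI[of _ "\<Phi> k y"]) (auto simp: \<Delta>_def)
      qed simp
    qed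
    moreover have "(\<Sum>k<n. \<psi> k x) * \<eta> \<le> 1 * \<eta>" using le1 \<eta> by (intro mult_right_mono)
    moreover have "(\<Sum>k<n. \<Lambda> k * e k) \<le> 2 * \<epsilon>"
    proof -
      have "(\<Sum>k<n. \<Lambda> k * e k) = (\<Sum>k<n. \<Lambda> k * \<tau> k) + (\<Sum>k<n. \<Lambda> k) * (3 * \<kappa> * \<rho> n)"
        by (simp add: e_def sum.distrib sum_distrib_right distrib_left)
      also have "(\<Sum>k<n. \<Lambda> k * \<tau> k) \<le> (\<Sum>k<n. \<epsilon> / 2 ^ Suc k)" using \<tau>\<Lambda> by (intro sum_mono)
      also have "\<dots> \<le> \<epsilon>" using \<epsilon> by (intro sum_half_powers_le) simp
      finally show ?thesis using \<rho>\<Lambda>[of n] by simp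
    qed
    ultimately show ?thesis by linarith
  qed

  have F': "norm (bderiv (F n) x) \<le> 3 * \<kappa>" if "a \<in> A" "dist x a < \<rho> n" for n x a
  proof -
    have "norm (bderiv (F n) x - 0) \<le> (1 - (\<Sum>k<n. \<psi> k x)) * norm (bderiv (G n) x - 0) + \<kappa> + 2 * \<epsilon>"
      using \<kappa> norm_bderiv_le_lipschitz[OF \<Phi>C1 \<Phi>lip] by (intro deriv[OF that]) auto
    moreover have "(1 - (\<Sum>k<n. \<psi> k x)) * norm (bderiv (G n) x) \<le> 1 * \<kappa>"
      using norm_bderiv_le_lipschitz[OF G Glip] le1[where x = x and n = n] nonneg by (intro mult_mono) (auto simp: sum_nonneg)
    ultimately show ?thesis using \<epsilon>(2) by simp
  qed
  have F0: "norm (bderiv (F 0) x) \<le> 3 * \<kappa>" for x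
    using norm_bderiv_le_lipschitz[OF G Glip, of 0 x] \<kappa> by (simp add: F_def glue_def[abs_def])
  have Fdiff: "norm (F (Suc n) x - F n x) \<le> 8 * \<kappa> * \<rho> (Suc n)" if a: "a \<in> A" "dist x a < \<rho> (Suc n)" for n x a
  proof -
    let ?s = "\<Sum>k<n. \<psi> k x"
    have s: "0 \<le> ?s" "?s \<le> 1" using nonneg le1 by (auto simp: sum_nonneg)
    have eq: "F (Suc n) x - F n x = (1 - ?s) *\<^sub>R (G (Suc n) x - G n x) + \<psi> n x *\<^sub>R (\<Delta> n x - G (Suc n) x)"
      by (simp add: F_def glue_def algebra_simps sum.distrib sum_subtractf scaleR_sum_left)
    have \<tau>1: "\<tau> n \<le> \<kappa> * \<rho> (Suc n)" "\<tau> (Suc n) \<le> \<kappa> * \<rho> (Suc n)"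
      using \<tau>\<rho>[of n] \<tau>\<rho>[of "Suc n"] mult_left_mono[OF \<rho>dec[of "Suc n"], of \<kappa>] \<kappa> by linarith+
    have d: "\<kappa> * dist x a \<le> \<kappa> * \<rho> (Suc n)" using a(2) \<kappa> by simp
    have "norm (G (Suc n) x - G n x) \<le> 4 * \<kappa> * \<rho> (Suc n)"
    proof -
      have "G (Suc n) x - G n x = (G (Suc n) x - G (Suc n) a) - (f a - G (Suc n) a) + (f a - G n a) - (G n x - G n a)" by simp
      also have "norm \<dots> \<le> norm (G (Suc n) x - G (Suc n) a) + norm (f a - G (Suc n) a) + norm (f a - G n a) + norm (G n x - G n a)"
        by (intro order.trans[OF norm_triangle_ineq4] add_mono order.trans[OF norm_triangle_ineq] order_refl)
      also have "\<dots> \<le> \<kappa> * dist x a + \<tau> (Suc n) + \<tau> n + \<kappa> * dist x a"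
        using lipschitz_onD[OF Glip, of x a] Gf[OF a(1)] by (intro add_mono) (auto simp: dist_norm)
      finally show ?thesis using \<tau>1 d by linarith
    qed
    hence 1: "norm ((1 - ?s) *\<^sub>R (G (Suc n) x - G n x)) \<le> 1 * (4 * \<kappa> * \<rho> (Suc n))"
      using s unfolding norm_scaleR by (intro mult_mono) auto
    have 2: "norm (\<psi> n x *\<^sub>R (\<Delta> n x - G (Suc n) x)) \<le> 1 * (4 * \<kappa> * \<rho> (Suc n))"
      using dich[of x n]
    proof (elim disjE exE bexE conjE)
      fix r :: real assume "r > 0" "\<forall>z\<in>ball x r. \<psi> n z = 0"
      thus ?thesis using \<kappa> \<rho>pos[of "Suc n"] by simp
    next
      fix y assume y: "y \<in> A" "ball x (t n) \<subseteq> U y" "\<forall>z\<in>ball x (t n). lab n z = y"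
      have "a \<in> U y" using a(2) \<rho>t[of n "Suc n"] y(2) by auto
      from model_close[OF y(1) a(1) this, of n x "Suc n"] \<tau>1 d
      have "norm (\<Phi> n y x - G (Suc n) x) \<le> 4 * \<kappa> * \<rho> (Suc n)" by linarith
      moreover have "\<Delta> n x = \<Phi> n y x" using y(3) t[of n] by (simp add: \<Delta>_def)
      ultimately show ?thesis using nonneg[of n x] \<psi>1[of n x] unfolding norm_scaleR by (intro mult_mono) auto
    qed
    show ?thesis unfolding eq using norm_triangle_mono[OF 1 2] by simp
  qed
  have F_partition: "F n x = (\<Sum>k<n. \<psi> k x *\<^sub>R \<Delta> k x)" if "(\<Sum>k<n. \<psi> k x) = 1" for n x
    using that by (simp add: F_def glue_def algebra_simps sum_subtractf flip: scaleR_sum_left)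
  have Fstat: "\<exists>N. \<exists>r>0. \<forall>n\<ge>N. \<forall>z\<in>ball a r. F n z = F N z" if a: "a \<in> A" for a
  proof -
    obtain N r where r: "r > 0" and N: "\<And>n z. n \<ge> N \<Longrightarrow> z \<in> ball a r \<Longrightarrow> (\<Sum>k<n. \<psi> k z) = 1"
      using one[of a] U(2) a by (metis UN_I)
    have "F n z = F N z" if nz: "n \<ge> N" "z \<in> ball a r" for n z
      using nz(1)
    proof (induction rule: dec_induct)
      case (step n)
      have "\<psi> n z = 0" using N[of n z] N[of "Suc n" z] step nz(2) by simp
      hence "F (Suc n) z = F n z"
        using F_partition[where n = n and x = z] F_partition[where n = "Suc n" and x = z] N[of n z] N[of "Suc n" z] step nz(2) by simp
      with step show ?case by simp
    qed simp
    with r show ?thesis by blast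
  qed
  obtain g where g: "C1_smooth g" "\<And>x. norm (bderiv g x) \<le> 3 * \<kappa> + 2 * K * (8 * \<kappa>)"
    and gF: "\<And>a. a \<in> A \<Longrightarrow> \<exists>N. \<exists>r>0. \<forall>n\<ge>N. \<forall>z\<in>ball a r. g z = F n z"
    by (rule diagonal_gluing[OF bump K A FC1 \<rho>pos \<rho>half F0 F' Fdiff Fstat]) blast+

  have near: "\<exists>N. \<forall>n\<ge>N. (\<Sum>k<n. \<psi> k a) = 1 \<and> g a = F n a \<and> bderiv g a = bderiv (F n) a" if a: "a \<in> A" for a
  proof -
    obtain N r where r: "r > 0" and N: "\<And>n z. n \<ge> N \<Longrightarrow> z \<in> ball a r \<Longrightarrow> (\<Sum>k<n. \<psi> k z) = 1"
      using one[of a] U(2) a by (metis UN_I)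
    obtain N' r' where r': "r' > 0" and N': "\<And>n z. n \<ge> N' \<Longrightarrow> z \<in> ball a r' \<Longrightarrow> g z = F n z"
      using gF[OF a] by metis
    have "bderiv g a = bderiv (F n) a" if "n \<ge> N'" for n
      by (rule bderiv_cong_open[OF FC1, of "ball a r'"]) (use r' N'[OF that] in auto)
    thus ?thesis using N[of _ a] N'[of _ a] r r' by (intro exI[of _ "max N N'"]) auto
  qed
  have gD: "norm (bderiv g a - D a) \<le> 3 * \<epsilon>" if a: "a \<in> A" for a
  proof -
    obtain n where n: "(\<Sum>k<n. \<psi> k a) = 1" "bderiv g a = bderiv (F n) a" using near[OF a] by blast
    have "norm (bderiv (F n) a - D a) \<le> (1 - (\<Sum>k<n. \<psi> k a)) * norm (bderiv (G n) a - D a) + \<epsilon> + 2 * \<epsilon>"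
    proof (rule deriv[OF a])
      fix k y assume y: "y \<in> A" "ball a (t k) \<subseteq> U y"
      hence "a \<in> U y" using t[of k] by auto
      with y(1) a show "norm (bderiv (\<Phi> k y) a - D a) \<le> \<epsilon>" by (intro \<Phi>D)
    qed (use \<rho>pos \<epsilon> in auto)
    thus ?thesis using n by simp
  qed

  \<comment> \<open>On \<open>A\<close> the error \<open>f - g\<close> is the sum of the errors \<open>v k\<close> of the single layers.\<close>
  define v where "v k a = \<psi> k a *\<^sub>R (f a - \<Delta> k a)" for k a
  have v_small: "norm (v k a) \<le> \<tau> k" if a: "a \<in> A" for k a
    using dich[of a k]
  proof (elim disjE exE bexE conjE)
    fix r :: real assume "r > 0" "\<forall>z\<in>ball a r. \<psi> k z = 0"
    thus ?thesis using \<tau>[of k] by (simp add: v_def)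
  next
    fix y assume y: "y \<in> A" "ball a (t k) \<subseteq> U y" "\<forall>z\<in>ball a (t k). lab k z = y"
    have "a \<in> ball a (t k)" using t[of k] by simp
    hence "a \<in> U y" "lab k a = y" using y by blast+
    hence "norm (f a - \<Delta> k a) \<le> \<tau> k" using \<Phi>f[OF y(1) a, of k] by (simp add: \<Delta>_def)
    hence "norm (v k a) \<le> 1 * \<tau> k" unfolding v_def norm_scaleR
      using nonneg[of k a] \<psi>1[of k a] by (intro mult_mono) auto
    thus ?thesis by simp
  qed
  have v_lip: "norm (v k a - v k b) \<le> (\<psi> k a * \<epsilon> + \<epsilon> / 2 ^ Suc k) * dist a b" if ab: "a \<in> A" "b \<in> A" for k a b
  proof (cases "dist a b < t k")
    case False
    have "norm (v k a - v k b) \<le> 2 * \<tau> k" using norm_triangle_ineq4[of "v k a" "v k b"] v_small[OF ab(1), of k] v_small[OF ab(2), of k]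
      by linarith
    also have "\<dots> \<le> \<epsilon> / 2 ^ Suc k * t k" by (rule \<tau>t)
    also have "\<dots> \<le> \<epsilon> / 2 ^ Suc k * dist a b" using False \<epsilon> by (intro mult_left_mono) auto
    also have "\<dots> \<le> (\<psi> k a * \<epsilon> + \<epsilon> / 2 ^ Suc k) * dist a b"
      using nonneg[of k a] \<epsilon> by (intro mult_right_mono) auto
    finally show ?thesis .
  next
    case True
    have active: ?thesis if y: "y \<in> A" "a \<in> U y" "b \<in> U y" "lab k a = y" "lab k b = y" for y
    proof -
      define e where "e x = f x - \<Phi> k y x" for x
      have "v k a - v k b = \<psi> k a *\<^sub>R (e a - e b) + (\<psi> k a - \<psi> k b) *\<^sub>R e b"
        using y(4,5) by (simp add: v_def \<Delta>_def e_def algebra_simps)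
      moreover have "norm (\<psi> k a *\<^sub>R (e a - e b)) \<le> \<psi> k a * (\<epsilon> * dist a b)"
        using lipschitz_onD[OF \<Phi>e[OF y(1)], of a b k] ab y nonneg[of k a]
        by (simp add: e_def dist_norm mult_left_mono)
      moreover have "norm ((\<psi> k a - \<psi> k b) *\<^sub>R e b) \<le> (\<Lambda> k * dist a b) * \<tau> k"
        unfolding norm_scaleR
        using lipschitz_onD[OF \<Lambda>, of a b k] \<Phi>f[OF y(1) ab(2) y(3), of k] \<Lambda>0[of k]
        by (intro mult_mono) (auto simp: e_def dist_real_def)
      moreover have "(\<Lambda> k * dist a b) * \<tau> k \<le> \<epsilon> / 2 ^ Suc k * dist a b"
        using mult_right_mono[OF \<tau>\<Lambda>[of k], of "dist a b"] by (simp add: mult_ac)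
      ultimately show ?thesis
        using norm_triangle_mono[of "\<psi> k a *\<^sub>R (e a - e b)" "\<psi> k a * (\<epsilon> * dist a b)" "(\<psi> k a - \<psi> k b) *\<^sub>R e b" "\<epsilon> / 2 ^ Suc k * dist a b"]
        by (simp add: distrib_right mult.assoc)
    qed
    have in_a: "b \<in> ball a (t k)" "a \<in> ball a (t k)" and in_b: "a \<in> ball b (t k)" "b \<in> ball b (t k)"
      using True t[of k] by (auto simp: dist_commute)
    consider y where "y \<in> A" "ball a (t k) \<subseteq> U y" "\<forall>z\<in>ball a (t k). lab k z = y"
      | y where "y \<in> A" "ball b (t k) \<subseteq> U y" "\<forall>z\<in>ball b (t k). lab k z = y"
      | "\<psi> k a = 0" "\<psi> k b = 0"
      using dich[of a k] dich[of b k] by (metis centre_in_ball)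
    thus ?thesis
    proof cases
      case (1 y)
      thus ?thesis using in_a by (intro active) auto
    next
      case (2 y)
      thus ?thesis using in_b by (intro active) auto
    next
      case 3
      thus ?thesis using \<epsilon> by (simp add: v_def)
    qed
  qed
  have "(3 * \<epsilon>)-lipschitz_on A (\<lambda>x. f x - g x)"
  proof (rule lipschitz_onI)
    fix a b assume ab: "a \<in> A" "b \<in> A"
    obtain N where N: "\<forall>n\<ge>N. (\<Sum>k<n. \<psi> k a) = 1 \<and> g a = F n a \<and> bderiv g a = bderiv (F n) a"
      using near[OF ab(1)] by blast
    obtain N' where N': "\<forall>n\<ge>N'. (\<Sum>k<n. \<psi> k b) = 1 \<and> g b = F n b \<and> bderiv g b = bderiv (F n) b"
      using near[OF ab(2)] by blast
    define n where "n = max N N'"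
    have na: "(\<Sum>k<n. \<psi> k a) = 1" "g a = F n a" using N by (auto simp: n_def)
    have nb: "(\<Sum>k<n. \<psi> k b) = 1" "g b = F n b" using N' by (auto simp: n_def)
    have fv: "f x - g x = (\<Sum>k<n. v k x)" if "(\<Sum>k<n. \<psi> k x) = 1" "g x = F n x" for x
      unfolding that(2) F_partition[OF that(1)]
      using that(1) by (simp add: v_def scaleR_diff_right sum_subtractf flip: scaleR_sum_left)
    have "f a - g a - (f b - g b) = (\<Sum>k<n. v k a - v k b)"
      using fv[OF na] fv[OF nb] by (simp add: sum_subtractf)
    also have "norm \<dots> \<le> (\<Sum>k<n. (\<psi> k a * \<epsilon> + \<epsilon> / 2 ^ Suc k) * dist a b)"
      by (intro order.trans[OF norm_sum] sum_mono v_lip ab)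
    also have "\<dots> = ((\<Sum>k<n. \<psi> k a) * \<epsilon> + (\<Sum>k<n. \<epsilon> / 2 ^ Suc k)) * dist a b"
      by (simp only: sum_distrib_right sum.distrib flip: sum_distrib_right)
    also have "\<dots> \<le> (3 * \<epsilon>) * dist a b"
      using na(1) sum_half_powers_le[of \<epsilon> n] \<epsilon> by (intro mult_right_mono) auto
    finally show "dist (f a - g a) (f b - g b) \<le> 3 * \<epsilon> * dist a b" by (simp add: dist_norm)
  qed (use \<epsilon> in auto)
  with g gD show ?thesis by (intro exI[of _ g]) (simp add: algebra_simps)
qed

section \<open>From approximation to extension\<close>

lemma C1_smooth_strictly_differentiable:
  assumes g: "C1_smooth g" and e: "e > 0"
  shows "\<exists>r>0. e-lipschitz_on (ball y r) (\<lambda>z. g z - bderiv g y z)"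
proof -
  have "continuous (at y) (bderiv g)"
    using C1_smooth_continuous_bderiv[OF g] by (simp add: continuous_on_eq_continuous_at)
  then obtain r where r: "r > 0" "\<And>z. dist z y < r \<Longrightarrow> dist (bderiv g z) (bderiv g y) < e"
    using e unfolding continuous_at_eps_delta by blast
  have "e-lipschitz_on (ball y r) (\<lambda>z. g z - bderiv g y z)"
  proof (rule bderiv_bound_imp_lipschitz)
    show "C1_smooth (\<lambda>z. g z - bderiv g y z)" by (intro C1_smooth_diff g C1_smooth_blinfun)
    fix z assume "z \<in> ball y r"
    thus "norm (bderiv (\<lambda>z. g z - bderiv g y z) z) \<le> e"
      using r(2)[of z] by (simp add: bderiv_diff g C1_smooth_blinfun bderiv_blinfun dist_norm[symmetric] dist_commute)
  qed (use e in auto)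
  with r(1) show ?thesis by blast
qed

text \<open>
  The error of an approximation inherits the mean value condition, since a continuously
  differentiable mapping satisfies it for its own derivative.
\<close>
lemma mean_value_condition_diff_C1:
  assumes mvc: "mean_value_condition_bounded A f D" and g: "C1_smooth g"
    and bound: "\<And>x. x \<in> A \<Longrightarrow> norm (D x - bderiv g x) \<le> B"
  shows "mean_value_condition_bounded A (\<lambda>x. f x - g x) (\<lambda>x. D x - bderiv g x)"
  unfolding mean_value_condition_bounded_def
proof (intro conjI ballI allI impI)
  show "continuous_on A (\<lambda>x. D x - bderiv g x)"
    using mvc C1_smooth_continuous_bderiv[OF g] unfolding mean_value_condition_bounded_def
    by (blast intro: continuous_on_diff continuous_on_subset)
  show "bdd_above ((\<lambda>y. norm (D y - bderiv g y)) ` A)" using bound by (intro bdd_aboveI[of _ B]) auto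
  fix y \<epsilon> assume y: "y \<in> A" and \<epsilon>: "(\<epsilon> :: real) > 0"
  hence \<epsilon>2: "\<epsilon> / 2 > 0" by simp
  obtain r where r: "r > 0" "\<And>z w. z \<in> A \<inter> ball y r \<Longrightarrow> w \<in> A \<inter> ball y r \<Longrightarrow>
      norm (f z - f w - D y (z - w)) \<le> \<epsilon> / 2 * norm (z - w)"
    using mvc y \<epsilon>2 unfolding mean_value_condition_bounded_def by meson
  obtain r' where r': "r' > 0" "(\<epsilon>/2)-lipschitz_on (ball y r') (\<lambda>z. g z - bderiv g y z)"
    using C1_smooth_strictly_differentiable[OF g \<epsilon>2] by blast
  show "\<exists>r>0. \<forall>z\<in>A \<inter> ball y r. \<forall>w\<in>A \<inter> ball y r.
      norm (f z - g z - (f w - g w) - blinfun_apply (D y - bderiv g y) (z - w)) \<le> \<epsilon> * norm (z - w)"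
  proof (intro exI[of _ "min r r'"] conjI ballI)
    fix z w assume zw: "z \<in> A \<inter> ball y (min r r')" "w \<in> A \<inter> ball y (min r r')"
    have 1: "norm (f z - f w - D y (z - w)) \<le> \<epsilon> / 2 * norm (z - w)" using zw by (intro r(2)) auto
    have 2: "norm ((g z - bderiv g y z) - (g w - bderiv g y w)) \<le> \<epsilon> / 2 * norm (z - w)"
      using zw by (intro lipschitz_on_normD[OF r'(2)]) auto
    have "f z - g z - (f w - g w) - blinfun_apply (D y - bderiv g y) (z - w)
        = (f z - f w - D y (z - w)) - ((g z - bderiv g y z) - (g w - bderiv g y w))"
      by (simp add: blinfun.diff_left blinfun.diff_right)
    also have "norm \<dots> \<le> \<epsilon> / 2 * norm (z - w) + \<epsilon> / 2 * norm (z - w)"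
      using norm_triangle_ineq4 1 2 by (rule order.trans[OF _ add_mono])
    finally show "norm (f z - g z - (f w - g w) - blinfun_apply (D y - bderiv g y) (z - w)) \<le> \<epsilon> * norm (z - w)"
      by simp
  qed (use r r' in auto)
qed

text \<open>
  On a small ball around \<open>y\<close> the mapping \<open>f - D y\<close> is \<open>\<epsilon>\<close>-Lipschitz on \<open>A\<close>, so it is approximated
  by smooth \<open>h\<close> with Lipschitz constant \<open>C\<^sub>0 * \<epsilon>\<close>; the local model is \<open>D y + h\<close>.  The normalisation at \<open>a\<^sub>0\<close>
  turns bounds on Lipschitz constants into bounds on values when the step is iterated.
\<close>
lemma C1_approximation_halving:
  fixes f :: "'a::banach \<Rightarrow> 'b::banach" and D :: "'a \<Rightarrow> 'a \<Rightarrow>\<^sub>L 'b"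
  assumes appr: "C1_approximation C\<^sub>0 TYPE('a) TYPE('b)" and C0: "C\<^sub>0 \<ge> 1"
    and bump: "\<And>(S :: 'a set) d. d > 0 \<Longrightarrow> \<exists>w. smooth_bump K S d w" and K: "K \<ge> 0"
    and A: "closed A" "a\<^sub>0 \<in> A" and B: "B > 0"
    and f: "B-lipschitz_on A f" and D: "\<And>y. y \<in> A \<Longrightarrow> norm (D y) \<le> B"
    and mvc: "mean_value_condition_bounded A f D"
  shows "\<exists>g. C1_smooth g \<and> (\<forall>x. norm (bderiv g x) \<le> (6 + 32 * K) * C\<^sub>0 * B) \<and> g a\<^sub>0 = f a\<^sub>0 \<and>
    (\<forall>x\<in>A. norm (D x - bderiv g x) \<le> B / 2) \<and> (B / 2)-lipschitz_on A (\<lambda>x. f x - g x)"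
proof -
  \<comment> \<open>The local models have error \<open>\<epsilon> + C\<^sub>0 * \<epsilon> \<le> B / 6\<close>, which gluing triples.\<close>
  define \<epsilon> where "\<epsilon> = B / (12 * C\<^sub>0)"
  have \<epsilon>: "\<epsilon> > 0" using B C0 by (simp add: \<epsilon>_def)
  have \<epsilon>C0: "C\<^sub>0 * \<epsilon> = B / 12" using C0 by (simp add: \<epsilon>_def)
  have \<epsilon>_le: "\<epsilon> \<le> B / 12" using mult_right_mono[OF C0, of \<epsilon>] \<epsilon> \<epsilon>C0 by simp
  have B_le: "B \<le> C\<^sub>0 * B" using mult_right_mono[OF C0, of B] B by simp
  have "\<forall>y\<in>A. \<exists>r>0. (\<forall>z\<in>A \<inter> ball y r. \<forall>w\<in>A \<inter> ball y r. norm (f z - f w - D y (z - w)) \<le> \<epsilon> * norm (z - w))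
      \<and> (\<forall>x\<in>A \<inter> ball y r. norm (D x - D y) \<le> \<epsilon>)"
  proof
    fix y assume y: "y \<in> A"
    obtain r where r: "r > 0" "\<forall>z\<in>A \<inter> ball y r. \<forall>w\<in>A \<inter> ball y r. norm (f z - f w - D y (z - w)) \<le> \<epsilon> * norm (z - w)"
      using mvc y \<epsilon> unfolding mean_value_condition_bounded_def by meson
    have "continuous_on A D" using mvc unfolding mean_value_condition_bounded_def by simp
    then obtain r' where r': "r' > 0" "\<forall>x\<in>A. dist x y < r' \<longrightarrow> dist (D x) (D y) < \<epsilon>"
      using y \<epsilon> unfolding continuous_on_iff by meson
    show "\<exists>r>0. (\<forall>z\<in>A \<inter> ball y r. \<forall>w\<in>A \<inter> ball y r. norm (f z - f w - D y (z - w)) \<le> \<epsilon> * norm (z - w))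
        \<and> (\<forall>x\<in>A \<inter> ball y r. norm (D x - D y) \<le> \<epsilon>)"
    proof (intro exI[of _ "min r r'"] conjI ballI)
      show "norm (D x - D y) \<le> \<epsilon>" if "x \<in> A \<inter> ball y (min r r')" for x
        using r'(2) that by (auto simp: dist_norm[of "D _"] dist_commute intro: less_imp_le)
    qed (use r r' in auto)
  qed
  then obtain r where "\<forall>y\<in>A. r y > 0 \<and> (\<forall>z\<in>A \<inter> ball y (r y). \<forall>w\<in>A \<inter> ball y (r y). norm (f z - f w - D y (z - w)) \<le> \<epsilon> * norm (z - w))
      \<and> (\<forall>x\<in>A \<inter> ball y (r y). norm (D x - D y) \<le> \<epsilon>)"
    unfolding bchoice_iff by (rule exE)
  hence r: "r y > 0" and rf: "\<forall>z\<in>A \<inter> ball y (r y). \<forall>w\<in>A \<inter> ball y (r y). norm (f z - f w - D y (z - w)) \<le> \<epsilon> * norm (z - w)"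
    and rD: "\<forall>x\<in>A \<inter> ball y (r y). norm (D x - D y) \<le> \<epsilon>" if "y \<in> A" for y
    using that by simp_all
  have glob: "\<exists>G. C1_smooth G \<and> (2 * C\<^sub>0 * B)-lipschitz_on UNIV G \<and> (\<forall>x\<in>A. norm (f x - G x) \<le> \<tau>)" if \<tau>: "\<tau> > 0" for \<tau>
  proof -
    obtain G where "C1_smooth G" "(C\<^sub>0 * B)-lipschitz_on UNIV G" "\<And>x. x \<in> A \<Longrightarrow> norm (f x - G x) < \<tau>"
      using C1_approximationE[OF appr f \<tau>] by metis
    thus ?thesis using B_le B by (intro exI[of _ G]) (auto intro: less_imp_le lipschitz_on_le)
  qed
  have loc: "local_models (2 * C\<^sub>0 * B) (B / 6) A f D (ball y (r y))" if y: "y \<in> A" for y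
    unfolding local_models_def
  proof (intro allI impI)
    fix \<tau> :: real assume \<tau>: "\<tau> > 0"
    have lip: "\<epsilon>-lipschitz_on (A \<inter> ball y (r y)) (\<lambda>x. f x - D y x)"
    proof (rule lipschitz_onI)
      fix z w assume zw: "z \<in> A \<inter> ball y (r y)" "w \<in> A \<inter> ball y (r y)"
      have "f z - D y z - (f w - D y w) = f z - f w - D y (z - w)" by (simp add: blinfun.diff_right)
      moreover have "norm (f z - f w - D y (z - w)) \<le> \<epsilon> * norm (z - w)" using rf[OF y] zw by blast
      ultimately show "dist (f z - D y z) (f w - D y w) \<le> \<epsilon> * dist z w" by (simp only: dist_norm)
    qed (use \<epsilon> in simp)
    obtain h where h: "C1_smooth h" "(C\<^sub>0 * \<epsilon>)-lipschitz_on UNIV h"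
      "\<And>x. x \<in> A \<inter> ball y (r y) \<Longrightarrow> norm (f x - D y x - h x) < \<tau>"
      using C1_approximationE[OF appr lip \<tau>] by metis
    define \<Phi> where "\<Phi> x = D y x + h x" for x
    have C1: "C1_smooth \<Phi>" unfolding \<Phi>_def[abs_def] by (intro C1_smooth_add C1_smooth_blinfun h)
    have bd: "bderiv \<Phi> x = D y + bderiv h x" for x
      unfolding \<Phi>_def[abs_def] by (simp add: bderiv_add C1_smooth_blinfun h bderiv_blinfun)
    have h': "norm (bderiv h x) \<le> B / 12" for x
      using norm_bderiv_le_lipschitz[OF h(1,2)] \<epsilon>C0 by simp
    have "norm (bderiv \<Phi> x) \<le> 2 * C\<^sub>0 * B" for x
      unfolding bd using norm_triangle_ineq[of "D y" "bderiv h x"] D[OF y] h'[of x] B B_le by linarith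
    hence "(2 * C\<^sub>0 * B)-lipschitz_on UNIV \<Phi>"
      using B C0 by (intro bderiv_bound_imp_lipschitz[OF C1]) auto
    moreover have "norm (f x - \<Phi> x) \<le> \<tau>" if "x \<in> A \<inter> ball y (r y)" for x
      using h(3)[OF that] by (simp add: \<Phi>_def diff_diff_eq)
    moreover have "norm (bderiv \<Phi> x - D x) \<le> B / 6" if "x \<in> A \<inter> ball y (r y)" for x
    proof -
      have "norm (bderiv \<Phi> x - D x) = norm (bderiv h x - (D x - D y))" by (simp add: bd algebra_simps)
      also have "\<dots> \<le> norm (bderiv h x) + norm (D x - D y)" by (rule norm_triangle_ineq4)
      also have "\<dots> \<le> B / 6" using h'[of x] bspec[OF rD[OF y] that] \<epsilon>_le by linarith
      finally show ?thesis .
    qed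
    moreover have "(B / 6)-lipschitz_on (A \<inter> ball y (r y)) (\<lambda>x. f x - \<Phi> x)"
    proof -
      have "(\<epsilon> + C\<^sub>0 * \<epsilon>)-lipschitz_on (A \<inter> ball y (r y)) (\<lambda>x. (f x - D y x) - h x)"
        by (intro lipschitz_on_diff lip lipschitz_on_subset[OF h(2)]) simp
      hence "(B / 6)-lipschitz_on (A \<inter> ball y (r y)) (\<lambda>x. (f x - D y x) - h x)"
        using \<epsilon>_le \<epsilon>C0 by (elim lipschitz_on_le) linarith
      thus ?thesis by (simp add: \<Phi>_def diff_diff_eq)
    qed
    ultimately show "\<exists>\<Phi>. C1_smooth \<Phi> \<and> (2 * C\<^sub>0 * B)-lipschitz_on UNIV \<Phi> \<and>
        (\<forall>x\<in>A \<inter> ball y (r y). norm (f x - \<Phi> x) \<le> \<tau> \<and> norm (bderiv \<Phi> x - D x) \<le> B / 6) \<and>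
        (B / 6)-lipschitz_on (A \<inter> ball y (r y)) (\<lambda>x. f x - \<Phi> x)"
      using C1 by (intro exI[of _ \<Phi>]) simp
  qed
  have "\<exists>g. C1_smooth g \<and> (\<forall>x. norm (bderiv g x) \<le> (3 + 16 * K) * (2 * C\<^sub>0 * B)) \<and>
      (\<forall>x\<in>A. norm (bderiv g x - D x) \<le> 3 * (B / 6)) \<and> (3 * (B / 6))-lipschitz_on A (\<lambda>x. f x - g x)"
  proof (rule glue_local_models[where U = "\<lambda>y. ball y (r y)", OF bump K])
    show "2 * (B / 6) \<le> 2 * C\<^sub>0 * B" using B_le B by linarith
  qed (use A B r glob loc in auto)
  then obtain g where g: "C1_smooth g" and g': "\<forall>x. norm (bderiv g x) \<le> (3 + 16 * K) * (2 * C\<^sub>0 * B)"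
    and gD: "\<forall>x\<in>A. norm (bderiv g x - D x) \<le> 3 * (B / 6)" and gf: "(3 * (B / 6))-lipschitz_on A (\<lambda>x. f x - g x)"
    by (elim exE conjE)
  define c where "c = f a\<^sub>0 - g a\<^sub>0"
  have bd: "bderiv (\<lambda>x. g x + c) x = bderiv g x" for x
    by (simp add: bderiv_add g C1_smooth_const bderiv_const)
  have "(B / 2 + 0)-lipschitz_on A (\<lambda>x. (f x - g x) - c)"
    using gf by (intro lipschitz_on_diff lipschitz_on_constant) simp
  hence lip: "(B / 2)-lipschitz_on A (\<lambda>x. f x - (g x + c))" by (simp add: diff_diff_eq)
  show ?thesis
  proof (intro exI[of _ "\<lambda>x. g x + c"] conjI allI ballI lip)
    show "C1_smooth (\<lambda>x. g x + c)" by (intro C1_smooth_add g C1_smooth_const)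
    show "norm (bderiv (\<lambda>x. g x + c) x) \<le> (6 + 32 * K) * C\<^sub>0 * B" for x
      unfolding bd using spec[OF g', of x] by (simp add: algebra_simps)
    show "norm (D x - bderiv (\<lambda>x. g x + c) x) \<le> B / 2" if "x \<in> A" for x
      unfolding bd using bspec[OF gD that] by (simp add: norm_minus_commute)
  qed (simp add: c_def)
qed

lemma C1_smooth_series:
  fixes g :: "nat \<Rightarrow> 'a::banach \<Rightarrow> 'b::banach"
  assumes g: "\<And>n. C1_smooth (g n)" and bound: "\<And>n x. norm (bderiv (g n) x) \<le> M / 2 ^ n"
    and base: "summable (\<lambda>n. g n a\<^sub>0)"
  shows "\<exists>G. C1_smooth G \<and> (2 * M)-lipschitz_on UNIV G \<and> (\<forall>x. (\<lambda>n. g n x) sums G x)"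
proof -
  define G' where "G' x = (\<Sum>n. bderiv (g n) x)" for x
  have geo: "(\<lambda>n. M / 2 ^ n) sums (2 * M)"
    using sums_mult[OF geometric_sums[of "1/2 :: real"], of M] by (simp add: power_divide mult.commute)
  have sum: "summable (\<lambda>n. norm (bderiv (g n) x))" for x
    by (rule summable_comparison_test'[OF sums_summable[OF geo]]) (use bound in auto)
  have unif: "uniform_limit UNIV (\<lambda>n x. \<Sum>i<n. bderiv (g i) x) G' sequentially"
    unfolding G'_def [abs_def] by (rule Weierstrass_m_test[OF _ sums_summable[OF geo]]) (use bound in auto)
  have G'_bound: "norm (G' x) \<le> 2 * M" for x
  proof -
    have "norm (G' x) \<le> (\<Sum>n. norm (bderiv (g n) x))" unfolding G'_def by (rule summable_norm[OF sum])
    also have "\<dots> \<le> (\<Sum>n. M / 2 ^ n)" by (intro suminf_le bound sum sums_summable[OF geo])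
    finally show ?thesis using geo by (simp add: sums_iff)
  qed
  have cont: "continuous_on UNIV G'"
    by (rule uniform_limit_theorem[OF _ unif])
      (auto intro!: always_eventually continuous_on_sum C1_smooth_continuous_bderiv g)
  have "\<exists>G. \<forall>x\<in>UNIV. (\<lambda>n. g n x) sums G x \<and> (G has_derivative blinfun_apply (G' x)) (at x within UNIV)"
  proof (rule has_derivative_series[where f' = "\<lambda>n x. blinfun_apply (bderiv (g n) x)"])
    show "(\<lambda>n. g n a\<^sub>0) sums (\<Sum>n. g n a\<^sub>0)" using base by (rule summable_sums)
    show "(g n has_derivative blinfun_apply (bderiv (g n) x)) (at x within UNIV)" for n x
      using C1_smooth_has_derivative[OF g] by simp
    fix e :: real assume "e > 0"
    from uniform_limitD[OF unif this]
    show "\<forall>\<^sub>F n in sequentially. \<forall>x\<in>UNIV. \<forall>h. norm ((\<Sum>i<n. bderiv (g i) x h) - G' x h) \<le> e * norm h"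
    proof (eventually_elim, intro ballI allI)
      fix n x h assume *: "\<forall>x\<in>UNIV. dist (\<Sum>i<n. bderiv (g i) x) (G' x) < e"
      have "(\<Sum>i<n. bderiv (g i) x h) - G' x h = ((\<Sum>i<n. bderiv (g i) x) - G' x) h"
        by (simp add: blinfun.diff_left blinfun.sum_left)
      also have "norm \<dots> \<le> norm ((\<Sum>i<n. bderiv (g i) x) - G' x) * norm h" by (rule norm_blinfun)
      also have "\<dots> \<le> e * norm h" using * by (intro mult_right_mono) (auto simp: dist_norm less_imp_le)
      finally show "norm ((\<Sum>i<n. bderiv (g i) x h) - G' x h) \<le> e * norm h" .
    qed
  qed auto
  then obtain G where G: "\<And>x. (\<lambda>n. g n x) sums G x" "\<And>x. (G has_derivative blinfun_apply (G' x)) (at x)"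
    by auto
  have C1: "C1_smooth G" by (rule C1_smoothI[OF G(2) cont])
  have "bderiv G = G'" using bderiv_eqI[OF G(2)] by blast
  hence "(2 * M)-lipschitz_on UNIV G"
    using G'_bound order.trans[OF norm_ge_zero G'_bound[of 0]] by (intro bderiv_bound_imp_lipschitz[OF C1]) auto
  with C1 G(1) show ?thesis by blast
qed

text \<open>
  After \<open>n\<close> halving steps the remaining error on \<open>A\<close> is \<open>B / 2 ^ n\<close>-Lipschitz and vanishes at \<open>a\<^sub>0\<close>, so it
  tends to \<open>0\<close> at every point of \<open>A\<close>, and the corrections form a convergent series of smooth mappings.
\<close>
lemma C1_approximation_extension:
  fixes f :: "'a::banach \<Rightarrow> 'b::banach" and D :: "'a \<Rightarrow> 'a \<Rightarrow>\<^sub>L 'b"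
  assumes appr: "C1_approximation C\<^sub>0 TYPE('a) TYPE('b)" and C0: "C\<^sub>0 \<ge> 1"
    and bump: "\<And>(S :: 'a set) d. d > 0 \<Longrightarrow> \<exists>w. smooth_bump K S d w" and K: "K \<ge> 0"
    and A: "closed A" "A \<noteq> {}" and B: "B > 0"
    and f: "B-lipschitz_on A f" and D: "\<And>y. y \<in> A \<Longrightarrow> norm (D y) \<le> B"
    and mvc: "mean_value_condition_bounded A f D"
  shows "\<exists>G. C1_smooth G \<and> (2 * ((6 + 32 * K) * C\<^sub>0 * B))-lipschitz_on UNIV G \<and> (\<forall>x\<in>A. G x = f x)"
proof -
  obtain a\<^sub>0 where a0: "a\<^sub>0 \<in> A" using A(2) by blast
  define M where "M = (6 + 32 * K) * C\<^sub>0 * B"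
  \<comment> \<open>The state \<open>s\<close> of the iteration consists of the remaining error and its candidate derivative.\<close>
  define P where "P n s \<longleftrightarrow> (B / 2 ^ n)-lipschitz_on A (fst s) \<and> (\<forall>y\<in>A. norm (snd s y) \<le> B / 2 ^ n) \<and>
      mean_value_condition_bounded A (fst s) (snd s) \<and> (n = 0 \<longrightarrow> s = (f, D)) \<and> (n > 0 \<longrightarrow> fst s a\<^sub>0 = 0)"
    for n :: nat and s :: "('a \<Rightarrow> 'b) \<times> ('a \<Rightarrow> 'a \<Rightarrow>\<^sub>L 'b)"
  define Q where "Q n s s' \<longleftrightarrow> (\<exists>g. C1_smooth g \<and> (\<forall>x. norm (bderiv g x) \<le> M / 2 ^ n) \<and> (\<forall>x. fst s' x = fst s x - g x))"
    for n :: nat and s s' :: "('a \<Rightarrow> 'b) \<times> ('a \<Rightarrow> 'a \<Rightarrow>\<^sub>L 'b)"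
  have "\<exists>s. \<forall>n. P n (s n) \<and> Q n (s n) (s (Suc n))"
  proof (rule dependent_nat_choice)
    show "\<exists>s. P 0 s" using f D mvc by (intro exI[of _ "(f, D)"]) (simp add: P_def)
    fix s n assume s: "P n s"
    have "\<exists>g. C1_smooth g \<and> (\<forall>x. norm (bderiv g x) \<le> (6 + 32 * K) * C\<^sub>0 * (B / 2 ^ n)) \<and> g a\<^sub>0 = fst s a\<^sub>0 \<and>
      (\<forall>x\<in>A. norm (snd s x - bderiv g x) \<le> B / 2 ^ n / 2) \<and> (B / 2 ^ n / 2)-lipschitz_on A (\<lambda>x. fst s x - g x)"
      by (rule C1_approximation_halving[OF appr C0 bump K A(1) a0]) (use s B in \<open>auto simp: P_def\<close>)
    then obtain g where g: "C1_smooth g" "\<forall>x. norm (bderiv g x) \<le> (6 + 32 * K) * C\<^sub>0 * (B / 2 ^ n)" "g a\<^sub>0 = fst s a\<^sub>0"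
      "\<forall>x\<in>A. norm (snd s x - bderiv g x) \<le> B / 2 ^ n / 2" "(B / 2 ^ n / 2)-lipschitz_on A (\<lambda>x. fst s x - g x)"
      by (elim exE conjE)
    define s' where "s' = ((\<lambda>x. fst s x - g x), (\<lambda>x. snd s x - bderiv g x))"
    have "mean_value_condition_bounded A (\<lambda>x. fst s x - g x) (\<lambda>x. snd s x - bderiv g x)"
      using s g(1,4) by (intro mean_value_condition_diff_C1) (auto simp: P_def)
    hence "P (Suc n) s'" using g(3-5) by (simp add: P_def s'_def mult.commute)
    moreover have "Q n s s'" unfolding Q_def using g(1,2) by (intro exI[of _ g]) (simp add: s'_def M_def)
    ultimately show "\<exists>s'. P (Suc n) s' \<and> Q n s s'" by blast
  qed
  then obtain s where s: "\<And>n. P n (s n)" and Q: "\<And>n. Q n (s n) (s (Suc n))" by auto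
  obtain g where g: "\<forall>n. C1_smooth (g n) \<and> (\<forall>x. norm (bderiv (g n) x) \<le> M / 2 ^ n) \<and> (\<forall>x. fst (s (Suc n)) x = fst (s n) x - g n x)"
    using Q unfolding Q_def choice_iff[symmetric] by metis
  have rest: "fst (s n) x = f x - (\<Sum>k<n. g k x)" for n x
  proof (induction n)
    case 0
    show ?case using s[of 0] by (simp add: P_def)
  qed (use g in simp)
  have sums: "(\<lambda>n. g n a) sums f a" if a: "a \<in> A" for a
  proof -
    have "(\<lambda>n. fst (s n) a) \<longlonglongrightarrow> 0"
    proof (rule Lim_null_comparison)
      show "\<forall>\<^sub>F n in sequentially. norm (fst (s n) a) \<le> B * norm (a - a\<^sub>0) * (1 / 2) ^ n"
        unfolding eventually_sequentially
      proof (intro exI[of _ 1] allI impI)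
        fix n :: nat assume "1 \<le> n"
        hence "(B / 2 ^ n)-lipschitz_on A (fst (s n))" "fst (s n) a\<^sub>0 = 0" using s[of n] by (auto simp: P_def)
        from lipschitz_on_normD[OF this(1) a a0] this(2)
        show "norm (fst (s n) a) \<le> B * norm (a - a\<^sub>0) * (1 / 2) ^ n" by (simp add: power_divide)
      qed
      have "(\<lambda>n. B * norm (a - a\<^sub>0) * (1 / 2) ^ n) \<longlonglongrightarrow> B * norm (a - a\<^sub>0) * 0"
        by (intro tendsto_mult_left LIMSEQ_power_zero) simp
      thus "(\<lambda>n. B * norm (a - a\<^sub>0) * (1 / 2) ^ n) \<longlonglongrightarrow> 0" by simp
    qed
    hence "(\<lambda>n. f a - fst (s n) a) \<longlonglongrightarrow> f a - 0" by (intro tendsto_diff tendsto_const)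
    thus ?thesis by (simp add: sums_def rest)
  qed
  have "\<exists>G. C1_smooth G \<and> (2 * M)-lipschitz_on UNIV G \<and> (\<forall>x. (\<lambda>n. g n x) sums G x)"
    using g sums[OF a0] by (intro C1_smooth_series[where a\<^sub>0 = a\<^sub>0]) (auto simp: sums_iff)
  then obtain G where G: "C1_smooth G" "(2 * M)-lipschitz_on UNIV G" "\<And>x. (\<lambda>n. g n x) sums G x" by blast
  have "G x = f x" if "x \<in> A" for x using sums_unique2[OF G(3) sums[OF that]] .
  with G(1,2) show ?thesis unfolding M_def by blast
qed

lemma sup_norm_upper:
  assumes "bdd_above ((\<lambda>y. norm (D y)) ` A)" "y \<in> A"
  shows "norm (D y) \<le> sup_norm A D"
proof -
  have "norm (D y) \<le> (SUP y\<in>A. norm (D y))" using assms by (intro cSUP_upper)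
  thus ?thesis using assms(2) by (auto simp: sup_norm_def)
qed

text \<open>
  The iteration needs a positive bound \<open>B\<close> and a nonzero vector in the target space.  In the degenerate
  cases \<open>f\<close> is constant on \<open>A\<close>.
\<close>
lemma property_star_imp_extension:
  assumes "property_star TYPE('a::banach) TYPE('b::banach)"
  shows "C1_Lipschitz_extension_property TYPE('a) TYPE('b)"
proof -
  obtain C\<^sub>0 where C0: "C\<^sub>0 \<ge> 1" and appr: "C1_approximation C\<^sub>0 TYPE('a) TYPE('b)"
    using property_star_imp_C1_approximation[OF assms] by metis
  have trivial: "\<exists>G :: 'a \<Rightarrow> 'b. C1_smooth G \<and> lipschitz_map UNIV G \<and> (\<forall>x\<in>A. G x = f x) \<and> Lip UNIV G \<le> b"
    if "\<And>x. x \<in> A \<Longrightarrow> f x = c" "b \<ge> 0" for A f b and c :: 'b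
  proof (intro exI[of _ "\<lambda>_. c"] conjI)
    have "0-lipschitz_on UNIV (\<lambda>_ :: 'a. c)" by (rule lipschitz_on_constant)
    thus "lipschitz_map UNIV (\<lambda>_ :: 'a. c)" "Lip UNIV (\<lambda>_ :: 'a. c) \<le> b"
      using Lip_le that(2) by (auto simp: lipschitz_map_def intro: order.trans)
  qed (use that in \<open>auto simp: C1_smooth_const\<close>)
  have nonneg: "0 \<le> sup_norm A D + Lip A f"
    if "lipschitz_map A f" "mean_value_condition_bounded A f D" for A :: "'a set" and f :: "'a \<Rightarrow> 'b" and D
  proof -
    have "0 \<le> sup_norm A D"
    proof (cases "A = {}")
      case False
      then obtain y where "y \<in> A" by blast
      hence "norm (D y) \<le> sup_norm A D"
        using that(2) by (intro sup_norm_upper) (auto simp: mean_value_condition_bounded_def)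
      thus ?thesis using norm_ge_zero order.trans by blast
    qed (simp add: sup_norm_def)
    thus ?thesis using lipschitz_on_nonneg[OF lipschitz_on_Lip[OF that(1)]] by simp
  qed
  show ?thesis
  proof (cases "\<exists>e :: 'b. e \<noteq> 0")
    case False
    hence "f x = 0" for f :: "'a \<Rightarrow> 'b" and x by blast
    hence "\<exists>G. C1_smooth G \<and> lipschitz_map UNIV G \<and> (\<forall>x\<in>A. G x = f x) \<and> Lip UNIV G \<le> 1 * (sup_norm A D + Lip A f)"
      if "lipschitz_map A f" "mean_value_condition_bounded A f D" for A :: "'a set" and f :: "'a \<Rightarrow> 'b" and D
      using nonneg[OF that] by (intro trivial[where c = 0]) simp_all
    thus ?thesis unfolding C1_Lipschitz_extension_property_def by blast
  next
    case True
    then obtain e :: 'b where "e \<noteq> 0" by blast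
    then obtain K' where K': "K' > 0" "C1_approximation K' TYPE('a) TYPE(real)"
      using C1_approximation_scalar[OF appr C0] by metis
    obtain K where K: "K > 0" "\<And>(S :: 'a set) d. d > 0 \<Longrightarrow> \<exists>w. smooth_bump K S d w"
      using smooth_bump_exists[OF K'(2,1)] by metis
    define C where "C = 2 * ((6 + 32 * K) * C\<^sub>0)"
    have C: "C \<ge> 1"
    proof -
      have "1 * 1 \<le> (6 + 32 * K) * C\<^sub>0" using K C0 by (intro mult_mono) auto
      thus ?thesis by (simp add: C_def)
    qed
    have "\<exists>G. C1_smooth G \<and> lipschitz_map UNIV G \<and> (\<forall>x\<in>A. G x = f x) \<and> Lip UNIV G \<le> C * (sup_norm A D + Lip A f)"
      if A: "closed A" and f: "lipschitz_map A f" and mvc: "mean_value_condition_bounded A f D"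
      for A :: "'a set" and f :: "'a \<Rightarrow> 'b" and D
    proof -
      define B where "B = sup_norm A D + Lip A f"
      have B0: "B \<ge> 0" unfolding B_def by (rule nonneg[OF f mvc])
      have lipf: "(Lip A f)-lipschitz_on A f" by (rule lipschitz_on_Lip[OF f])
      have L0: "Lip A f \<ge> 0" using lipf by (rule lipschitz_on_nonneg)
      have Dle: "norm (D y) \<le> sup_norm A D" if "y \<in> A" for y
        using mvc that by (intro sup_norm_upper) (auto simp: mean_value_condition_bounded_def)
      show ?thesis
      proof (cases "A = {}")
        case True
        thus ?thesis using trivial[of A f 0 "C * B"] B0 C by (simp add: B_def)
      next
        case ne: False
        then obtain a where a: "a \<in> A" by blast
        have s0: "sup_norm A D \<ge> 0" using Dle[OF a] norm_ge_zero order.trans by blast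
        show ?thesis
        proof (cases "B = 0")
          case True
          hence "Lip A f = 0" using s0 L0 by (simp add: B_def)
          hence "f x = f a" if "x \<in> A" for x using lipschitz_on_normD[OF lipf that a] by simp
          thus ?thesis using trivial[of A f "f a" "C * B"] B0 C by (simp add: B_def)
        next
          case False
          have "\<exists>G. C1_smooth G \<and> (2 * ((6 + 32 * K) * C\<^sub>0 * B))-lipschitz_on UNIV G \<and> (\<forall>x\<in>A. G x = f x)"
          proof (rule C1_approximation_extension[OF appr C0 K(2)])
            show "B-lipschitz_on A f" using lipf s0 by (elim lipschitz_on_le) (simp add: B_def)
            show "norm (D y) \<le> B" if "y \<in> A" for y using Dle[OF that] L0 by (simp add: B_def)
          qed (use K A ne False B0 mvc in auto)
          then obtain G where G: "C1_smooth G" "(C * B)-lipschitz_on UNIV G" "\<forall>x\<in>A. G x = f x"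
            by (auto simp: C_def mult.assoc)
          from Lip_le[OF G(2)] G show ?thesis unfolding B_def lipschitz_map_def by blast
        qed
      qed
    qed
    with C show ?thesis unfolding C1_Lipschitz_extension_property_def by blast
  qed
qed

theorem proposition3p8:
  shows "(C1_Lipschitz_extension_property TYPE('x::banach) TYPE('z::banach)
            \<longrightarrow> property_star TYPE('x) TYPE('z)) \<and>
         (C1_Lipschitz_extension_property TYPE('x) TYPE('z)
            \<longleftrightarrow> property_star TYPE('x) TYPE('z))"
  using extension_imp_property_star property_star_imp_extension by blast

end
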